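(* Let $(A,\circ,\Delta)$ be a finite-dimensional ASI bialgebra, let $(d_1,\partial_1)$ and $(d_2,\partial_2)$ be coherent derivations on $(A,\circ,\Delta)$, and suppose that $d_1$ commutes with $d_2$ and $\partial_1$ commutes with $\partial_2$. Let $\cdot$ be the dual operation of $\Delta$ on $A^*$, and let $((A_h,\circ_h),(A_h^\star,\cdot_h),l_{\circ_h},r_{\circ_h},l_{\cdot_h},r_{\cdot_h})$ be the associative matched pair deformation induced by $((A,\circ),(A^*,\cdot),R_\circ^*,L_\circ^*,R_\cdot^*,L_\cdot^*,d_1\dotplus\partial_1^*,d_2\dotplus\partial_2^* )$. Suppose that $$d_1(x)\circ d_2(y)=\partial_2(x\circ d_1(y)),\qquad d_1(x)\circ d_2(y)=\partial_1(d_2(x)\circ y),\qquad\forall x,y\in A,$$ $$(\partial_1\otimes\partial_2)\Delta=(\mathrm{id}_A\otimes\partial_1)\Delta d_2,\qquad(\partial_1\otimes\partial_2)\Delta=(\partial_2\otimes\mathrm{id}_A)\Delta d_1.$$ Let $(A_h,\circ_h,\Delta_h)$ be the ASI bialgebra deformation induced by $(A,\circ,d_1,d_2,\Delta,\partial_1,\partial_2)$. Then the matched pair of topologically free associative algebras corresponding to $(A_h,\circ_h,\Delta_h)$ coincides with $((A_h,\circ_h),(A_h^\star,\cdot_h),l_{\circ_h},r_{\circ_h},l_{\cdot_h},r_{\cdot_h})$.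
   Context: Conventions. $\mathbf{k}$ is a field of characteristic $0$, $\mathbf{K}=\mathbf{k}[[h]]$; vector spaces, algebras, tensor products are over $\mathbf{k}$; no units/counits required. $V_h:=V[[h]]\supset V$. $\hat\otimes$ is the $h$-adic completion of $\otimes_{\mathbf{K}}$, so $V_h\hat\otimes W_h\cong(V\otimes W)[[h]]$. $\sigma$ is the flip. $L_\circ(x)y=x\circ y$, $R_\circ(x)y=y\circ x$ (likewise for other operations). Duals. $V^*=\mathrm{Hom}_{\mathbf{k}}(V,\mathbf{k})$ with pairing $\langle,\rangle$; $T^*$ is the transpose of a linear map $T$. For $\varrho:A\to\mathrm{End}(V)$, $\langle\varrho^*(x)u^*,v\rangle=\langle u^*,\varrho(x)v\rangle$. $V_h^\star:=(V^* )_h\cong\mathrm{Hom}_{\mathbf{K}}(V_h,\mathbf{K})$ with $\mathbf{K}$-bilinear pairing $\langle,\rangle_{\mathbf{K}}$ extending $\langle,\rangle$; for $\varrho_h:A_h\to\mathrm{End}_{\mathbf{K}}(V_h)$, $\langle\varrho_h^\star(x')u^\star,v'\rangle_{\mathbf{K}}=\langle u^\star,\varrho_h(x')v'\rangle_{\mathbf{K}}$. For $A$ finite-dimensional, $A^{**}=A$, $(A_h^\star)^\star=A_h$. Dual operation of $\Delta$: $\langle a^*\cdot b^*,x\rangle=\langle a^*\otimes b^*,\Delta(x)\rangle$. Topological dual operation of $\Delta_h:A_h\to A_h\hat\otimes A_h$: the operation on $A_h^\star$ sending $(a^\star,b^\star)$ to the element pairing with $x_h$ as $\langle a^\star\hat\otimes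 b^\star,\Delta_h(x_h)\rangle_{\mathbf{K}}$. ASI bialgebra $(A,\circ,\Delta)$: $(A,\circ)$ associative algebra, $(A,\Delta)$ coassociative coalgebra, and for all $x,y$: $\Delta(x\circ y)=(\mathrm{id}\otimes L_\circ(x))\Delta(y)+(R_\circ(y)\otimes\mathrm{id})\Delta(x)$, $(L_\circ(y)\otimes\mathrm{id}-\mathrm{id}\otimes R_\circ(y))\Delta(x)+\sigma\big((L_\circ(x)\otimes\mathrm{id}-\mathrm{id}\otimes R_\circ(x))\Delta(y)\big)=0$. Coderivation on $(A,\Delta)$: linear $\partial$ with $\Delta\partial=(\partial\otimes\mathrm{id}+\mathrm{id}\otimes\partial)\Delta$. Coherent derivation: a pair $(d,\partial)$, $d$ a derivation on $(A,\circ)$, $\partial$ a coderivation on $(A,\Delta)$, with $\partial(x)\circ y=x\circ d(y)+\partial(x\circ y)$, $x\circ\partial(y)=d(x)\circ y+\partial(x\circ y)$ for all $x,y\in A$, $(d\otimes\mathrm{id})\Delta=(\mathrm{id}\otimes\partial)\Delta+\Delta d$, $(\mathrm{id}\otimes d)\Delta=(\partial\otimes\mathrm{id})\Delta+\Delta d$. Under the four displayed conditions, the ASI bialgebra deformation induced by $(A,\circ,d_1,d_2,\Delta,\partial_1,\partial_2)$ is $(A_h,\circ_h,\Delta_h)$ with $A_h=A[[h]]$, $x\circ_h y=\sum_{s\ge0}d_1^s(x)\circ d_2^s(y)\frac{h^s}{s!}$, $\Delta_h(x)=\sum_{s\ge0}(\partial_1^s\otimes\partial_2^s)\Delta(x)\frac{h^s}{s!}$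 for $x,y\in A$, extended $\mathbf{K}$-(bi)linearly. Matched pair of associative algebras $((A,\circ),(B,\cdot),l_\circ,r_\circ,l_\cdot,r_\cdot)$: associative algebras and linear maps $l_\circ,r_\circ:A\to\mathrm{End}(B)$, $l_\cdot,r_\cdot:B\to\mathrm{End}(A)$ such that $(x,u)\odot(y,v)=(x\circ y+l_\cdot(u)y+r_\cdot(v)x,\ l_\circ(x)v+r_\circ(y)u+u\cdot v)$ is associative on $A\oplus B$; the resulting algebra is $A\bowtie_{l_\cdot,r_\cdot}^{l_\circ,r_\circ}B$. Matched pair of topologically free associative algebras: the same over $\mathbf{K}$, with $\mathbf{K}$-modules isomorphic to some $V[[h]]$ and $\mathbf{K}$-linear maps. For linear $f,g$ on $A,B$, $(f\dotplus g)(x,v)=(f(x),g(v))$ on $A\oplus B$. Known: for $(A,\circ,\Delta)$ finite-dimensional, $((A,\circ),(A^*,\cdot),R_\circ^*,L_\circ^*,R_\cdot^*,L_\cdot^* )$ is a matched pair, and $d_i\dotplus\partial_i^*$ are (commuting) derivations of $A\bowtie_{R_\cdot^*,L_\cdot^*}^{R_\circ^*,L_\circ^*}A^*$. Given a matched pair $((A,\circ),(B,\cdot),l_\circ,r_\circ,l_\cdot,r_\cdot)$ and commuting derivations $D_1,D_2$ of $A\bowtie_{l_\cdot,r_\cdot}^{l_\circ,r_\circ}B$ preserving $A$ and $B$, the induced associative matched pair deformation is $((A_h,\circ_h),(B_h,\cdot_h),l_{\circ_h},r_{\circ_h},l_{\cdot_h},r_{\cdot_h})$ with $x\circ_h y=\sum_s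 D_1^s(x)\circ D_2^s(y)\frac{h^s}{s!}$, $u\cdot_h v=\sum_s D_1^s(u)\cdot D_2^s(v)\frac{h^s}{s!}$, $l_{\circ_h}(x)v=\sum_s l_\circ(D_1^s(x))D_2^s(v)\frac{h^s}{s!}$, $r_{\circ_h}(x)v=\sum_s r_\circ(D_2^s(x))D_1^s(v)\frac{h^s}{s!}$, $l_{\cdot_h}(v)x=\sum_s l_\cdot(D_1^s(v))D_2^s(x)\frac{h^s}{s!}$, $r_{\cdot_h}(v)x=\sum_s r_\cdot(D_2^s(v))D_1^s(x)\frac{h^s}{s!}$ for $x,y\in A$, $u,v\in B$, extended $\mathbf{K}$-linearly. The matched pair of topologically free associative algebras corresponding to a topologically free ASI bialgebra $(A_h,\circ_h,\Delta_h)$ is $((A_h,\circ_h),(A_h^\star,\cdot'_h),R^\star_{\circ_h},L^\star_{\circ_h},R^\star_{\cdot'_h},L^\star_{\cdot'_h})$ with $\cdot'_h$ the topological dual operation of $\Delta_h$. *)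

theory Defs
  imports
    "HOL-Computational_Algebra.Formal_Power_Series"
    "HOL-Library.Function_Algebras"
begin

unbundle fps_syntax

section \<open>Duals and bilinear maps\<close>

text \<open>A vector space over a field \<open>'k\<close> is a whole type \<open>'a\<close> with a scalar multiplication
  \<open>s :: 'k \<Rightarrow> 'a \<Rightarrow> 'a\<close> satisfying \<^const>\<open>vector_space\<close>. Its dual is a set of functions,
  on which the vector space structure is pointwise.\<close>

definition fun_scale :: "'k::field \<Rightarrow> ('x \<Rightarrow> 'k) \<Rightarrow> ('x \<Rightarrow> 'k)" where
  "fun_scale c f = (\<lambda>x. c * f x)"

definition dual_space :: "('k::field \<Rightarrow> 'a::ab_group_add \<Rightarrow> 'a) \<Rightarrow> ('a \<Rightarrow> 'k) set" where
  "dual_space s = {f. Vector_Spaces.linear s (*) f}"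

definition transpose_map :: "('a \<Rightarrow> 'b) \<Rightarrow> ('b \<Rightarrow> 'k) \<Rightarrow> ('a \<Rightarrow> 'k)" where
  "transpose_map T u = (\<lambda>v. u (T v))"

definition bilinear_map ::
  "('k::field \<Rightarrow> 'a::ab_group_add \<Rightarrow> 'a) \<Rightarrow> ('k \<Rightarrow> 'b::ab_group_add \<Rightarrow> 'b) \<Rightarrow>
   ('k \<Rightarrow> 'c::ab_group_add \<Rightarrow> 'c) \<Rightarrow> ('a \<Rightarrow> 'b \<Rightarrow> 'c) \<Rightarrow> bool" where
  "bilinear_map s1 s2 s3 b \<longleftrightarrow>
     (\<forall>x. Vector_Spaces.linear s2 s3 (b x)) \<and> (\<forall>y. Vector_Spaces.linear s1 s3 (\<lambda>x. b x y))"

abbreviation bilinear_form ::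
  "('k::field \<Rightarrow> 'a::ab_group_add \<Rightarrow> 'a) \<Rightarrow> ('k \<Rightarrow> 'b::ab_group_add \<Rightarrow> 'b) \<Rightarrow> ('a \<Rightarrow> 'b \<Rightarrow> 'k) \<Rightarrow> bool" where
  "bilinear_form s1 s2 \<equiv> bilinear_map s1 s2 (*)"


section \<open>Tensor products\<close>

text \<open>\<open>V \<otimes> W\<close> is realised inside the dual of the space of bilinear forms on \<open>V \<times> W\<close>: the tensor
  \<open>x \<otimes> y\<close> is evaluation at \<open>(x, y)\<close>, and \<open>V \<otimes> W\<close> is the span of these. Functionals on bilinear
  forms are encoded as functions on all \<open>\<beta> :: 'a \<Rightarrow> 'b \<Rightarrow> 'k\<close> that vanish when \<open>\<beta>\<close> is not bilinear,
  so that equality of tensors is equality in HOL. The universal property is proved below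
  (\<open>tensor_universal\<close>).\<close>

type_synonym ('a, 'b, 'k) tensor = "('a \<Rightarrow> 'b \<Rightarrow> 'k) \<Rightarrow> 'k"

definition tens ::
  "('k::field \<Rightarrow> 'a::ab_group_add \<Rightarrow> 'a) \<Rightarrow> ('k \<Rightarrow> 'b::ab_group_add \<Rightarrow> 'b) \<Rightarrow> 'a \<Rightarrow> 'b \<Rightarrow> ('a, 'b, 'k) tensor" where
  "tens s1 s2 x y = (\<lambda>\<beta>. if bilinear_form s1 s2 \<beta> then \<beta> x y else 0)"

definition tensor_space ::
  "('k::field \<Rightarrow> 'a::ab_group_add \<Rightarrow> 'a) \<Rightarrow> ('k \<Rightarrow> 'b::ab_group_add \<Rightarrow> 'b) \<Rightarrow> ('a, 'b, 'k) tensor set" where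
  "tensor_space s1 s2 = module.span fun_scale {tens s1 s2 x y |x y. True}"

text \<open>\<open>f \<otimes> g\<close>; the scalar multiplications \<open>t1\<close>, \<open>t2\<close> are those of the codomains.\<close>

definition tensor_map ::
  "('k::field \<Rightarrow> 'c::ab_group_add \<Rightarrow> 'c) \<Rightarrow> ('k \<Rightarrow> 'd::ab_group_add \<Rightarrow> 'd) \<Rightarrow>
   ('a \<Rightarrow> 'c) \<Rightarrow> ('b \<Rightarrow> 'd) \<Rightarrow> ('a, 'b, 'k) tensor \<Rightarrow> ('c, 'd, 'k) tensor" where
  "tensor_map t1 t2 f g t = (\<lambda>\<beta>. if bilinear_form t1 t2 \<beta> then t (\<lambda>x y. \<beta> (f x) (g y)) else 0)"

definition tensor_flip :: "('a, 'b, 'k) tensor \<Rightarrow> ('b, 'a, 'k) tensor" where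
  "tensor_flip t = (\<lambda>\<beta>. t (\<lambda>x y. \<beta> y x))"

text \<open>\<open>A \<otimes> A \<otimes> A\<close> is realised in the same way by trilinear forms. The maps \<open>\<Delta> \<otimes> id\<close> and
  \<open>id \<otimes> \<Delta>\<close> from \<open>A \<otimes> A\<close> to \<open>A \<otimes> A \<otimes> A\<close> are given for linear \<open>\<Delta>\<close> with values in \<open>A \<otimes> A\<close>
  (see \<open>comult_id_tens\<close>, \<open>id_comult_tens\<close>).\<close>

definition trilinear_form ::
  "('k::field \<Rightarrow> 'a::ab_group_add \<Rightarrow> 'a) \<Rightarrow> ('a \<Rightarrow> 'a \<Rightarrow> 'a \<Rightarrow> 'k) \<Rightarrow> bool" where
  "trilinear_form s \<tau> \<longleftrightarrow>
     (\<forall>x y. \<tau> x y \<in> dual_space s \<and> (\<lambda>z. \<tau> x z y) \<in> dual_space s \<and> (\<lambda>z. \<tau> z x y) \<in> dual_space s)"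

definition tens3 ::
  "('k::field \<Rightarrow> 'a::ab_group_add \<Rightarrow> 'a) \<Rightarrow> 'a \<Rightarrow> 'a \<Rightarrow> 'a \<Rightarrow> ('a \<Rightarrow> 'a \<Rightarrow> 'a \<Rightarrow> 'k) \<Rightarrow> 'k" where
  "tens3 s x y z = (\<lambda>\<tau>. if trilinear_form s \<tau> then \<tau> x y z else 0)"

definition comult_id ::
  "('k::field \<Rightarrow> 'a::ab_group_add \<Rightarrow> 'a) \<Rightarrow> ('a \<Rightarrow> ('a, 'a, 'k) tensor) \<Rightarrow> ('a, 'a, 'k) tensor \<Rightarrow>
   ('a \<Rightarrow> 'a \<Rightarrow> 'a \<Rightarrow> 'k) \<Rightarrow> 'k" where
  "comult_id s \<Delta> t = (\<lambda>\<tau>. if trilinear_form s \<tau> then t (\<lambda>x z. \<Delta> x (\<lambda>p q. \<tau> p q z)) else 0)"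

definition id_comult ::
  "('k::field \<Rightarrow> 'a::ab_group_add \<Rightarrow> 'a) \<Rightarrow> ('a \<Rightarrow> ('a, 'a, 'k) tensor) \<Rightarrow> ('a, 'a, 'k) tensor \<Rightarrow>
   ('a \<Rightarrow> 'a \<Rightarrow> 'a \<Rightarrow> 'k) \<Rightarrow> 'k" where
  "id_comult s \<Delta> t = (\<lambda>\<tau>. if trilinear_form s \<tau> then t (\<lambda>x z. \<Delta> z (\<lambda>p q. \<tau> x p q)) else 0)"

text \<open>The functional \<open>a \<otimes> b\<close> on \<open>V \<otimes> W\<close>, for \<open>a \<in> V\<^sup>*\<close> and \<open>b \<in> W\<^sup>*\<close>.\<close>

definition dual_tens :: "('a \<Rightarrow> 'k::field) \<Rightarrow> ('b \<Rightarrow> 'k) \<Rightarrow> ('a, 'b, 'k) tensor \<Rightarrow> 'k" where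
  "dual_tens a b t = t (\<lambda>x y. a x * b y)"


subsection \<open>Calculation rules and universal property\<close>

lemma vector_space_fun_scale: "vector_space (fun_scale :: 'k::field \<Rightarrow> ('x \<Rightarrow> 'k) \<Rightarrow> 'x \<Rightarrow> 'k)"
  by unfold_locales (auto simp: fun_scale_def fun_eq_iff algebra_simps)

lemma vector_space_field: "vector_space ((*) :: 'k::field \<Rightarrow> 'k \<Rightarrow> 'k)"
  by unfold_locales (auto simp: algebra_simps)

lemma bilinear_map_iff:
  assumes "vector_space s1" "vector_space s2" "vector_space s3"
  shows "bilinear_map s1 s2 s3 b \<longleftrightarrow>
    (\<forall>x y z. b x (y + z) = b x y + b x z) \<and> (\<forall>x c y. b x (s2 c y) = s3 c (b x y)) \<and>
    (\<forall>x y z. b (x + y) z = b x z + b y z) \<and> (\<forall>x c y. b (s1 c x) y = s3 c (b x y))"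
  using assms unfolding bilinear_map_def Vector_Spaces.linear_iff by blast

lemma bilinear_tens:
  assumes "vector_space s1" "vector_space s2"
  shows "bilinear_map s1 s2 fun_scale (tens s1 s2)"
  unfolding bilinear_map_iff[OF assms vector_space_fun_scale]
  using bilinear_map_iff[OF assms vector_space_field]
  by (auto simp: tens_def fun_scale_def fun_eq_iff)

lemma tensor_map_tens:
  assumes "Vector_Spaces.linear s1 t1 f" "Vector_Spaces.linear s2 t2 g"
  shows "tensor_map t1 t2 f g (tens s1 s2 x y) = tens t1 t2 (f x) (g y)"
proof -
  have "bilinear_form s1 s2 (\<lambda>x y. \<beta> (f x) (g y))" if "bilinear_form t1 t2 \<beta>" for \<beta>
    using that assms by (simp add: bilinear_map_def Vector_Spaces.linear_iff)
  then show ?thesis by (auto simp: tensor_map_def tens_def fun_eq_iff)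
qed

lemma linear_tensor_map: "Vector_Spaces.linear fun_scale fun_scale (tensor_map t1 t2 f g)"
  unfolding Vector_Spaces.linear_iff
  by (intro conjI vector_space_fun_scale) (auto simp: tensor_map_def fun_scale_def fun_eq_iff)

lemma tensor_flip_tens: "tensor_flip (tens s1 s2 x y) = tens s2 s1 y x"
proof -
  have "bilinear_form s1 s2 (\<lambda>x y. \<beta> y x) \<longleftrightarrow> bilinear_form s2 s1 \<beta>" for \<beta>
    by (auto simp: bilinear_map_def)
  then show ?thesis by (auto simp: tensor_flip_def tens_def fun_eq_iff)
qed

lemma linear_tensor_flip: "Vector_Spaces.linear fun_scale fun_scale tensor_flip"
  unfolding Vector_Spaces.linear_iff
  by (intro conjI vector_space_fun_scale) (auto simp: tensor_flip_def fun_scale_def fun_eq_iff)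

lemma dual_tens_tens:
  assumes "a \<in> dual_space s1" "b \<in> dual_space s2"
  shows "dual_tens a b (tens s1 s2 x y) = a x * b y"
proof -
  have "bilinear_form s1 s2 (\<lambda>x y. a x * b y)"
    using assms by (simp add: dual_space_def bilinear_map_def Vector_Spaces.linear_iff algebra_simps)
  then show ?thesis by (simp add: dual_tens_def tens_def)
qed

lemma linear_dual_tens: "Vector_Spaces.linear fun_scale (*) (dual_tens a b)"
  unfolding Vector_Spaces.linear_iff
  by (intro conjI vector_space_fun_scale vector_space_field) (auto simp: dual_tens_def fun_scale_def)

lemma tensor_space_add_scale:
  fixes s1 :: "'k::field \<Rightarrow> 'a::ab_group_add \<Rightarrow> 'a" and s2 :: "'k \<Rightarrow> 'b::ab_group_add \<Rightarrow> 'b"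
  assumes t: "t \<in> tensor_space s1 s2" and vs: "vector_space s1" "vector_space s2"
    and \<beta>: "bilinear_form s1 s2 \<beta>" and \<gamma>: "bilinear_form s1 s2 \<gamma>"
  shows "t (\<lambda>x y. \<beta> x y + \<gamma> x y) = t \<beta> + t \<gamma>" and "t (\<lambda>x y. c * \<beta> x y) = c * t \<beta>"
proof -
  interpret T: vector_space "fun_scale :: 'k \<Rightarrow> ('a, 'b, 'k) tensor \<Rightarrow> ('a, 'b, 'k) tensor"
    by (rule vector_space_fun_scale)
  have 1: "bilinear_form s1 s2 (\<lambda>x y. \<beta> x y + \<gamma> x y)" "bilinear_form s1 s2 (\<lambda>x y. c * \<beta> x y)"
    using \<beta> \<gamma> unfolding bilinear_map_iff[OF vs vector_space_field] by (auto simp: algebra_simps)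
  have "t (\<lambda>x y. \<beta> x y + \<gamma> x y) = t \<beta> + t \<gamma> \<and> t (\<lambda>x y. c * \<beta> x y) = c * t \<beta>"
    using t unfolding tensor_space_def
    by (induction rule: T.span_induct_alt)
      (use \<beta> \<gamma> 1 in \<open>auto simp: tens_def fun_scale_def algebra_simps\<close>)
  then show "t (\<lambda>x y. \<beta> x y + \<gamma> x y) = t \<beta> + t \<gamma>" and "t (\<lambda>x y. c * \<beta> x y) = c * t \<beta>"
    by auto
qed

lemma trilinear_form_slices:
  assumes "vector_space s" "trilinear_form s \<tau>"
  shows "bilinear_form s s (\<lambda>p q. \<tau> p q z)" "bilinear_form s s (\<lambda>p q. \<tau> z p q)"
  using assms by (auto simp: trilinear_form_def dual_space_def bilinear_map_def)

lemma
  assumes vs: "vector_space s" and lin: "Vector_Spaces.linear s fun_scale \<Delta>"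
    and ran: "\<And>x. \<Delta> x \<in> tensor_space s s"
  shows comult_id_tens: "\<Delta> x = (\<Sum>i\<in>I. tens s s (p i) (q i)) \<Longrightarrow>
      comult_id s \<Delta> (tens s s x z) = (\<Sum>i\<in>I. tens3 s (p i) (q i) z)"
    and id_comult_tens: "\<Delta> z = (\<Sum>i\<in>I. tens s s (p i) (q i)) \<Longrightarrow>
      id_comult s \<Delta> (tens s s x z) = (\<Sum>i\<in>I. tens3 s x (p i) (q i))"
proof -
  have sum_apply: "(\<Sum>i\<in>I. f i) \<tau> = (\<Sum>i\<in>I. f i \<tau>)" for f :: "'c \<Rightarrow> 'd \<Rightarrow> 'a" and \<tau>
    by (induction I rule: infinite_finite_induct) auto
  have \<Delta>: "\<Delta> (x + y) \<beta> = \<Delta> x \<beta> + \<Delta> y \<beta>" "\<Delta> (s c x) \<beta> = c * \<Delta> x \<beta>" for x y c \<beta>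
    using lin by (auto simp: Vector_Spaces.linear_iff fun_scale_def)
  have 1: "bilinear_form s s (\<lambda>x z. \<Delta> x (\<lambda>p q. \<tau> p q z))"
          "bilinear_form s s (\<lambda>x z. \<Delta> z (\<lambda>p q. \<tau> x p q))" if \<tau>: "trilinear_form s \<tau>" for \<tau>
  proof -
    have split: "\<tau> p q (z + z') = \<tau> p q z + \<tau> p q z'" "\<tau> p q (s c z) = c * \<tau> p q z"
      "\<tau> (z + z') p q = \<tau> z p q + \<tau> z' p q" "\<tau> (s c z) p q = c * \<tau> z p q" for p q z z' c
      using \<tau> by (auto simp: trilinear_form_def dual_space_def Vector_Spaces.linear_iff)
    note slices = trilinear_form_slices[OF vs \<tau>]
    show "bilinear_form s s (\<lambda>x z. \<Delta> x (\<lambda>p q. \<tau> p q z))"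
      unfolding bilinear_map_iff[OF vs vs vector_space_field] split
      using tensor_space_add_scale[OF ran vs vs slices(1) slices(1)] by (simp add: \<Delta>)
    show "bilinear_form s s (\<lambda>x z. \<Delta> z (\<lambda>p q. \<tau> x p q))"
      unfolding bilinear_map_iff[OF vs vs vector_space_field] split
      using tensor_space_add_scale[OF ran vs vs slices(2) slices(2)] by (simp add: \<Delta>)
  qed
  show "comult_id s \<Delta> (tens s s x z) = (\<Sum>i\<in>I. tens3 s (p i) (q i) z)"
    if "\<Delta> x = (\<Sum>i\<in>I. tens s s (p i) (q i))"
    using that 1 trilinear_form_slices[OF vs]
    by (auto simp: comult_id_def fun_eq_iff sum_apply tens3_def tens_def)
  show "id_comult s \<Delta> (tens s s x z) = (\<Sum>i\<in>I. tens3 s x (p i) (q i))"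
    if "\<Delta> z = (\<Sum>i\<in>I. tens s s (p i) (q i))"
    using that 1 trilinear_form_slices[OF vs]
    by (auto simp: id_comult_def fun_eq_iff sum_apply tens3_def tens_def)
qed

lemma exists_dual_separating:
  assumes vs: "vector_space s" and "x \<noteq> y"
  shows "\<exists>f\<in>dual_space s. f x \<noteq> f y"
proof -
  interpret P: vector_space_pair s "(*)"
    by (intro vector_space_pair.intro vs vector_space_field)
  have "P.vs1.independent {x - y}" using assms by simp
  from P.linear_independent_extend[OF this, of "\<lambda>_. 1"]
  obtain g where g: "Vector_Spaces.linear s (*) g" "g (x - y) = 1" by auto
  then have "g x - g y = 1" using P.linear_diff[OF g(1), of x y] by simp
  then show ?thesis using g(1) by (auto simp: dual_space_def)
qed

lemma tensor_universal:
  assumes vs: "vector_space s1" "vector_space s2" "vector_space s3"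
    and b: "bilinear_map s1 s2 s3 b"
  shows "\<exists>L. Vector_Spaces.linear fun_scale s3 L \<and> (\<forall>x y. L (tens s1 s2 x y) = b x y) \<and>
    (\<forall>L'. Vector_Spaces.linear fun_scale s3 L' \<longrightarrow> (\<forall>x y. L' (tens s1 s2 x y) = b x y) \<longrightarrow>
      (\<forall>t\<in>tensor_space s1 s2. L' t = L t))"
proof -
  let ?T = "{tens s1 s2 x y |x y. True}"
  interpret P: vector_space_pair fun_scale s3
    by (intro vector_space_pair.intro vs vector_space_fun_scale)
  interpret Q: vector_space_pair fun_scale "(*)"
    by (intro vector_space_pair.intro vector_space_field vector_space_fun_scale)
  obtain B where B: "B \<subseteq> ?T" "P.vs1.independent B" "?T \<subseteq> P.vs1.span B"
    by (rule P.vs1.maximal_independent_subset)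
  have "\<forall>t\<in>B. \<exists>p. t = tens s1 s2 (fst p) (snd p)" using B(1) by force
  from bchoice[OF this] obtain p where p: "\<And>t. t \<in> B \<Longrightarrow> t = tens s1 s2 (fst (p t)) (snd (p t))"
    by blast
  define f g where "f t = fst (p t)" and "g t = snd (p t)" for t
  have fg: "t = tens s1 s2 (f t) (g t)" if "t \<in> B" for t
    using p[OF that] by (simp only: f_def g_def)
  obtain L where L: "Vector_Spaces.linear fun_scale s3 L" "\<And>t. t \<in> B \<Longrightarrow> L t = b (f t) (g t)"
    using P.linear_independent_extend[OF B(2), of "\<lambda>t. b (f t) (g t)"] by blast
  have Lb: "L (tens s1 s2 x y) = b x y" for x y
  proof (rule ccontr)
    assume "L (tens s1 s2 x y) \<noteq> b x y"
    then obtain \<phi> where \<phi>: "\<phi> \<in> dual_space s3" "\<phi> (L (tens s1 s2 x y)) \<noteq> \<phi> (b x y)"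
      using exists_dual_separating[OF vs(3)] by blast
    have bil: "bilinear_form s1 s2 (\<lambda>x y. \<phi> (b x y))"
      using \<phi>(1) b by (auto simp: dual_space_def bilinear_map_def Vector_Spaces.linear_iff)
    have 1: "Vector_Spaces.linear fun_scale (*) (\<lambda>t. \<phi> (L t))"
      using \<phi>(1) L(1) by (auto simp: dual_space_def Vector_Spaces.linear_iff)
    have 2: "Vector_Spaces.linear fun_scale (*) (\<lambda>t. t (\<lambda>x y. \<phi> (b x y)))"
      unfolding Vector_Spaces.linear_iff
      by (intro conjI vector_space_fun_scale vector_space_field) (auto simp: fun_scale_def)
    have "\<phi> (L (tens s1 s2 x y)) = tens s1 s2 x y (\<lambda>x y. \<phi> (b x y))"
    proof (rule Q.linear_eq_on[OF 1 2])
      show "tens s1 s2 x y \<in> P.vs1.span B" using B(3) by auto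
      show "\<phi> (L t) = t (\<lambda>x y. \<phi> (b x y))" if "t \<in> B" for t
      proof -
        have "t (\<lambda>x y. \<phi> (b x y)) = tens s1 s2 (f t) (g t) (\<lambda>x y. \<phi> (b x y))"
          by (subst fg[OF that]) (rule refl)
        then show ?thesis using L(2)[OF that] bil by (simp add: tens_def)
      qed
    qed
    also have "\<dots> = \<phi> (b x y)" using bil by (simp add: tens_def)
    finally show False using \<phi>(2) by simp
  qed
  have "L' t = L t" if "Vector_Spaces.linear fun_scale s3 L'" "\<forall>x y. L' (tens s1 s2 x y) = b x y"
    "t \<in> tensor_space s1 s2" for L' t
    using that(2,3) Lb unfolding tensor_space_def by (intro P.linear_eq_on[OF that(1) L(1), of t ?T]) auto
  with L(1) Lb show ?thesis by blast
qed


section \<open>ASI bialgebras and coherent derivations\<close>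

definition assoc_algebra ::
  "('k::field \<Rightarrow> 'a::ab_group_add \<Rightarrow> 'a) \<Rightarrow> ('a \<Rightarrow> 'a \<Rightarrow> 'a) \<Rightarrow> bool" where
  "assoc_algebra s m \<longleftrightarrow> bilinear_map s s s m \<and> (\<forall>x y z. m (m x y) z = m x (m y z))"

definition coassoc_coalgebra ::
  "('k::field \<Rightarrow> 'a::ab_group_add \<Rightarrow> 'a) \<Rightarrow> ('a \<Rightarrow> ('a, 'a, 'k) tensor) \<Rightarrow> bool" where
  "coassoc_coalgebra s \<Delta> \<longleftrightarrow>
     Vector_Spaces.linear s fun_scale \<Delta> \<and> (\<forall>x. \<Delta> x \<in> tensor_space s s) \<and>
     (\<forall>x. comult_id s \<Delta> (\<Delta> x) = id_comult s \<Delta> (\<Delta> x))"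

definition asi_bialgebra ::
  "('k::field \<Rightarrow> 'a::ab_group_add \<Rightarrow> 'a) \<Rightarrow> ('a \<Rightarrow> 'a \<Rightarrow> 'a) \<Rightarrow> ('a \<Rightarrow> ('a, 'a, 'k) tensor) \<Rightarrow> bool" where
  "asi_bialgebra s m \<Delta> \<longleftrightarrow>
     assoc_algebra s m \<and> coassoc_coalgebra s \<Delta> \<and>
     (let L = (\<lambda>x y. m x y); R = (\<lambda>x y. m y x) in
       (\<forall>x y. \<Delta> (m x y) = tensor_map s s id (L x) (\<Delta> y) + tensor_map s s (R y) id (\<Delta> x)) \<and>
       (\<forall>x y. (tensor_map s s (L y) id (\<Delta> x) - tensor_map s s id (R y) (\<Delta> x)) +
          tensor_flip (tensor_map s s (L x) id (\<Delta> y) - tensor_map s s id (R x) (\<Delta> y)) = 0))"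

definition derivation ::
  "('k::field \<Rightarrow> 'a::ab_group_add \<Rightarrow> 'a) \<Rightarrow> ('a \<Rightarrow> 'a \<Rightarrow> 'a) \<Rightarrow> ('a \<Rightarrow> 'a) \<Rightarrow> bool" where
  "derivation s m d \<longleftrightarrow> Vector_Spaces.linear s s d \<and> (\<forall>x y. d (m x y) = m (d x) y + m x (d y))"

definition coderivation ::
  "('k::field \<Rightarrow> 'a::ab_group_add \<Rightarrow> 'a) \<Rightarrow> ('a \<Rightarrow> ('a, 'a, 'k) tensor) \<Rightarrow> ('a \<Rightarrow> 'a) \<Rightarrow> bool" where
  "coderivation s \<Delta> p \<longleftrightarrow> Vector_Spaces.linear s s p \<and>
     (\<forall>x. \<Delta> (p x) = tensor_map s s p id (\<Delta> x) + tensor_map s s id p (\<Delta> x))"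

definition coherent_derivation ::
  "('k::field \<Rightarrow> 'a::ab_group_add \<Rightarrow> 'a) \<Rightarrow> ('a \<Rightarrow> 'a \<Rightarrow> 'a) \<Rightarrow> ('a \<Rightarrow> ('a, 'a, 'k) tensor) \<Rightarrow>
   ('a \<Rightarrow> 'a) \<Rightarrow> ('a \<Rightarrow> 'a) \<Rightarrow> bool" where
  "coherent_derivation s m \<Delta> d p \<longleftrightarrow>
     derivation s m d \<and> coderivation s \<Delta> p \<and>
     (\<forall>x y. m (p x) y = m x (d y) + p (m x y)) \<and>
     (\<forall>x y. m x (p y) = m (d x) y + p (m x y)) \<and>
     (\<forall>x. tensor_map s s d id (\<Delta> x) = tensor_map s s id p (\<Delta> x) + \<Delta> (d x)) \<and>
     (\<forall>x. tensor_map s s id d (\<Delta> x) = tensor_map s s p id (\<Delta> x) + \<Delta> (d x))"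


section \<open>Topologically free modules\<close>

text \<open>\<open>V[[h]]\<close> is the type \<open>'v fps\<close>, a module over \<open>'k fps\<close>. The completed tensor product of
  \<open>V[[h]]\<close> and \<open>W[[h]]\<close> is taken to be \<open>(V \<otimes> W)[[h]]\<close>.\<close>

definition scale_h :: "('k::field \<Rightarrow> 'v::ab_group_add \<Rightarrow> 'v) \<Rightarrow> 'k fps \<Rightarrow> 'v fps \<Rightarrow> 'v fps" where
  "scale_h s c v = Abs_fps (\<lambda>n. \<Sum>i=0..n. s (c $ i) (v $ (n - i)))"

text \<open>The \<open>'k fps\<close>-linear extension to \<open>V[[h]]\<close> of a linear map \<open>V \<rightarrow> W[[h]]\<close>
  (see \<open>ext_h_linear\<close>, \<open>ext_h_const\<close>, \<open>K_linear_eqI\<close>), and the bilinear analogue.\<close>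

definition ext_h :: "('v \<Rightarrow> 'w::comm_monoid_add fps) \<Rightarrow> 'v fps \<Rightarrow> 'w fps" where
  "ext_h \<phi> v = Abs_fps (\<lambda>n. \<Sum>i=0..n. \<phi> (v $ i) $ (n - i))"

definition ext2_h :: "('u \<Rightarrow> 'v \<Rightarrow> 'w::comm_monoid_add fps) \<Rightarrow> 'u fps \<Rightarrow> 'v fps \<Rightarrow> 'w fps" where
  "ext2_h b u v = ext_h (\<lambda>x. ext_h (b x) v) u"

text \<open>\<open>\<Sum>\<^sub>n a\<^sub>n h\<^sup>n / n!\<close>\<close>

definition exp_series :: "('k::field_char_0 \<Rightarrow> 'v \<Rightarrow> 'v) \<Rightarrow> (nat \<Rightarrow> 'v) \<Rightarrow> 'v fps" where
  "exp_series s a = Abs_fps (\<lambda>n. s (1 / fact n) (a n))"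

definition dual_h :: "('k::field \<Rightarrow> 'a::ab_group_add \<Rightarrow> 'a) \<Rightarrow> ('a \<Rightarrow> 'k) fps set" where
  "dual_h s = {u. \<forall>n. u $ n \<in> dual_space s}"

definition pair_h :: "('v \<Rightarrow> 'k::field) fps \<Rightarrow> 'v fps \<Rightarrow> 'k fps" where
  "pair_h = ext2_h (\<lambda>u v. fps_const (u v))"

definition dual_tens_h ::
  "('a \<Rightarrow> 'k::field) fps \<Rightarrow> ('b \<Rightarrow> 'k) fps \<Rightarrow> (('a, 'b, 'k) tensor \<Rightarrow> 'k) fps" where
  "dual_tens_h = ext2_h (\<lambda>a b. fps_const (dual_tens a b))"

text \<open>The identifications \<open>Hom(V[[h]], K) \<cong> V\<^sup>*[[h]]\<close>, \<open>V\<^sup>*\<^sup>* \<cong> V\<close> and \<open>Hom(V\<^sup>*[[h]], K) \<cong> V[[h]]\<close> for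
  finite-dimensional \<open>V\<close>. The described elements exist uniquely for linear arguments:
  see \<open>dual_h_elem_ex1\<close>, \<open>bidual_elem_ex1\<close>, \<open>bidual_h_elem_ex1\<close>.\<close>

definition dual_h_elem ::
  "('k::field \<Rightarrow> 'a::ab_group_add \<Rightarrow> 'a) \<Rightarrow> ('a fps \<Rightarrow> 'k fps) \<Rightarrow> ('a \<Rightarrow> 'k) fps" where
  "dual_h_elem s \<phi> = (THE w. w \<in> dual_h s \<and> (\<forall>v. pair_h w v = \<phi> v))"

definition bidual_elem ::
  "('k::field \<Rightarrow> 'a::ab_group_add \<Rightarrow> 'a) \<Rightarrow> (('a \<Rightarrow> 'k) \<Rightarrow> 'k) \<Rightarrow> 'a" where
  "bidual_elem s \<phi> = (THE v. \<forall>u \<in> dual_space s. u v = \<phi> u)"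

definition bidual_h_elem ::
  "('k::field \<Rightarrow> 'a::ab_group_add \<Rightarrow> 'a) \<Rightarrow> (('a \<Rightarrow> 'k) fps \<Rightarrow> 'k fps) \<Rightarrow> 'a fps" where
  "bidual_h_elem s \<phi> = (THE v. \<forall>u \<in> dual_h s. pair_h u v = \<phi> u)"


subsection \<open>Extensions and pairings are well-defined\<close>

lemma module_scale_h:
  assumes vs: "vector_space s"
  shows "module (scale_h s)"
proof -
  interpret V: vector_space s by fact
  show ?thesis
  proof
    fix c d :: "'a fps" and v w :: "'b fps"
    show "scale_h s c (v + w) = scale_h s c v + scale_h s c w"
      by (rule fps_ext) (simp add: scale_h_def V.scale_right_distrib sum.distrib)
    show "scale_h s (c + d) v = scale_h s c v + scale_h s d v"
      by (rule fps_ext) (simp add: scale_h_def V.scale_left_distrib sum.distrib)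
    show "scale_h s c (scale_h s d v) = scale_h s (c * d) v"
    proof (rule fps_ext)
      fix n
      show "scale_h s c (scale_h s d v) $ n = scale_h s (c * d) v $ n"
        using fps_mult_assoc_lemma[of "\<lambda>i j l. s (c $ i * d $ j) (v $ l)" n]
        by (simp add: scale_h_def fps_mult_nth V.scale_sum_left V.scale_sum_right)
    qed
    show "scale_h s 1 v = v"
    proof (rule fps_ext)
      fix n
      have "(\<Sum>i=0..n. s (1 $ i) (v $ (n - i))) = (\<Sum>i=0..n. if i = 0 then v $ n else 0)"
        by (rule sum.cong) (auto simp: fps_one_nth)
      then show "scale_h s 1 v $ n = v $ n" by (simp add: scale_h_def)
    qed
  qed
qed

lemma scale_h_field: "scale_h (*) = (*)"
  by (intro ext fps_ext) (simp add: scale_h_def fps_mult_nth)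

lemma ext_h_const: "\<phi> 0 = 0 \<Longrightarrow> ext_h \<phi> (fps_const x) = \<phi> x"
proof (rule fps_ext)
  fix n assume "\<phi> 0 = 0"
  then have "(\<Sum>i=0..n. \<phi> (fps_const x $ i) $ (n - i)) = (\<Sum>i=0..n. if i = 0 then \<phi> x $ n else 0)"
    by (intro sum.cong) auto
  then show "ext_h \<phi> (fps_const x) $ n = \<phi> x $ n" by (simp add: ext_h_def)
qed

lemma ext_h_linear:
  assumes s: "vector_space s" and t: "vector_space t"
    and \<phi>: "\<And>n. Vector_Spaces.linear s t (\<lambda>x. \<phi> x $ n)"
  shows "module_hom (scale_h s) (scale_h t) (ext_h \<phi>)"
proof -
  interpret T: vector_space t by fact
  have \<phi>': "\<phi> (x + y) $ n = \<phi> x $ n + \<phi> y $ n" "\<phi> (s c x) $ n = t c (\<phi> x $ n)" for x y c n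
    using \<phi>[of n] by (auto simp: Vector_Spaces.linear_iff)
  have \<phi>_sum: "\<phi> (\<Sum>i\<in>I. f i) $ n = (\<Sum>i\<in>I. \<phi> (f i) $ n)" for I :: "nat set" and f n
    using Vector_Spaces.linear.axioms(3)[OF \<phi>[of n]] by (rule module_hom.sum)
  show ?thesis
  proof (intro module_hom.intro module_hom_axioms.intro module_scale_h s t)
    show "ext_h \<phi> (v + w) = ext_h \<phi> v + ext_h \<phi> w" for v w
      by (rule fps_ext) (simp add: ext_h_def \<phi>' sum.distrib)
    show "ext_h \<phi> (scale_h s c v) = scale_h t c (ext_h \<phi> v)" for c v
    proof (rule fps_ext)
      fix n
      show "ext_h \<phi> (scale_h s c v) $ n = scale_h t c (ext_h \<phi> v) $ n"
        using fps_mult_assoc_lemma[of "\<lambda>i j l. t (c $ i) (\<phi> (v $ j) $ l)" n]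
        by (simp add: ext_h_def scale_h_def \<phi>' \<phi>_sum T.scale_sum_right)
    qed
  qed
qed

text \<open>Linear maps are determined by their values on \<open>V\<close>, because they commute
  with multiplication by \<open>h\<^sup>n\<close>.\<close>

lemma K_linear_eqI:
  assumes s: "vector_space s" and t: "vector_space t"
    and f: "module_hom (scale_h s) (scale_h t) f" and g: "module_hom (scale_h s) (scale_h t) g"
    and eq: "\<And>x. f (fps_const x) = g (fps_const x)"
  shows "f = g"
proof -
  interpret S: vector_space s by fact
  interpret T: vector_space t by fact
  interpret f: module_hom "scale_h s" "scale_h t" f by fact
  interpret g: module_hom "scale_h s" "scale_h t" g by fact
  have X: "scale_h r (fps_X ^ m) v = Abs_fps (\<lambda>n. if n < m then 0 else v $ (n - m))"
    if "vector_space r" for r :: "'a \<Rightarrow> 'x::ab_group_add \<Rightarrow> 'x" and m v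
  proof (rule fps_ext)
    fix n
    interpret R: vector_space r by fact
    have "(\<Sum>i=0..n. r (fps_X ^ m $ i) (v $ (n - i))) = (\<Sum>i=0..n. if i = m then v $ (n - m) else 0)"
      by (rule sum.cong) (auto simp: fps_X_power_iff)
    then show "scale_h r (fps_X ^ m) v $ n = Abs_fps (\<lambda>n. if n < m then 0 else v $ (n - m)) $ n"
      by (auto simp: scale_h_def)
  qed
  have dec: "v = (\<Sum>i<m. scale_h s (fps_X ^ i) (fps_const (v $ i))) +
      scale_h s (fps_X ^ m) (Abs_fps (\<lambda>n. v $ (n + m)))" for v m
  proof (induction m)
    case 0
    show ?case by (rule fps_ext) (simp add: X[OF s])
  next
    case (Suc m)
    have "scale_h s (fps_X ^ m) (Abs_fps (\<lambda>n. v $ (n + m))) =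
      scale_h s (fps_X ^ m) (fps_const (v $ m)) + scale_h s (fps_X ^ Suc m) (Abs_fps (\<lambda>n. v $ (n + Suc m)))"
      by (rule fps_ext) (auto simp: X[OF s] less_Suc_eq simp del: power_Suc)
    with Suc show ?case by (simp add: add.assoc del: power_Suc)
  qed
  have "f v $ n = g v $ n" for v n
    by (subst (1 2) dec[of v "Suc n"])
      (simp add: f.add g.add f.sum g.sum f.scale g.scale eq X[OF t] fps_sum_nth del: power_Suc)
  then show ?thesis by (simp add: fun_eq_iff fps_eq_iff)
qed

lemma pair_h_nth:
  assumes "u \<in> dual_h s"
  shows "pair_h u v $ n = (\<Sum>i=0..n. (u $ i) (v $ (n - i)))"
proof -
  have "(\<Sum>i=0..k. fps_const ((u $ m) (v $ i)) $ (k - i)) = (u $ m) (v $ k)" for m k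
  proof -
    have "(\<Sum>i=0..k. fps_const ((u $ m) (v $ i)) $ (k - i)) = (\<Sum>i=0..k. if i = k then (u $ m) (v $ k) else 0)"
      by (rule sum.cong) auto
    then show ?thesis by simp
  qed
  then show ?thesis by (simp add: pair_h_def ext2_h_def ext_h_def)
qed

lemma dual_h_elem_ex1:
  assumes s: "vector_space s" and \<phi>: "module_hom (scale_h s) (*) \<phi>"
  shows "\<exists>!w. w \<in> dual_h s \<and> (\<forall>v. pair_h w v = \<phi> v)"
proof -
  interpret S: vector_space s by fact
  interpret \<phi>: module_hom "scale_h s" "(*)" \<phi> by fact
  have const: "scale_h s (fps_const c) (fps_const x) = fps_const (s c x)" for c x
  proof (rule fps_ext)
    fix n
    have "(\<Sum>i=0..n. s (fps_const c $ i) (fps_const x $ (n - i))) = (\<Sum>i=0..n. if i = 0 then fps_const (s c x) $ n else 0)"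
      by (rule sum.cong) auto
    then show "scale_h s (fps_const c) (fps_const x) $ n = fps_const (s c x) $ n"
      by (simp add: scale_h_def)
  qed
  have pc: "pair_h w (fps_const x) $ n = (w $ n) x" if "w \<in> dual_h s" for w x n
  proof -
    have 0: "(w $ i) 0 = 0" for i
      using that by (auto simp: dual_h_def dual_space_def intro!: module_hom.zero dest: Vector_Spaces.linear.axioms(3))
    have "(\<Sum>i=0..n. (w $ i) (fps_const x $ (n - i))) = (\<Sum>i=0..n. if i = n then (w $ n) x else 0)"
      by (rule sum.cong) (auto simp: 0)
    then show ?thesis by (simp add: pair_h_nth[OF that])
  qed
  have hom: "module_hom (scale_h s) (scale_h (*)) (pair_h w)" if w: "w \<in> dual_h s" for w
  proof -
    have lin: "(w $ i) (x + y) = (w $ i) x + (w $ i) y" "(w $ i) (s c x) = c * (w $ i) x" for i x y c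
      using w by (auto simp: dual_h_def dual_space_def Vector_Spaces.linear_iff)
    have lin_sum: "(w $ i) (\<Sum>j\<in>J. f j) = (\<Sum>j\<in>J. (w $ i) (f j))" for i f and J :: "nat set"
      using w by (auto simp: dual_h_def dual_space_def intro!: module_hom.sum dest: Vector_Spaces.linear.axioms(3))
    show ?thesis
    proof (intro module_hom.intro module_hom_axioms.intro module_scale_h s vector_space_field)
      show "pair_h w (x + y) = pair_h w x + pair_h w y" for x y
        by (rule fps_ext) (simp add: pair_h_nth[OF w] lin sum.distrib)
      show "pair_h w (scale_h s c x) = scale_h (*) c (pair_h w x)" for c x
      proof (rule fps_ext)
        fix n
        have rev: "(\<Sum>j=0..i. c $ (i - j) * (w $ j) (x $ (n - i))) =
            (\<Sum>j=0..i. c $ j * (w $ (i - j)) (x $ (n - i)))" for i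
          by (subst sum.atLeastAtMost_rev) (auto intro!: sum.cong)
        have "pair_h w (scale_h s c x) $ n = (\<Sum>i=0..n. \<Sum>j=0..n-i. c $ j * (w $ i) (x $ (n - i - j)))"
          by (simp add: pair_h_nth[OF w] scale_h_def lin lin_sum)
        also have "\<dots> = (\<Sum>i=0..n. \<Sum>j=0..i. c $ (i - j) * (w $ j) (x $ (n - i)))"
          using fps_mult_assoc_lemma[of "\<lambda>j i l. c $ i * (w $ j) (x $ l)" n] by simp
        also have "\<dots> = (\<Sum>i=0..n. \<Sum>j=0..i. c $ j * (w $ (i - j)) (x $ (n - i)))"
          by (simp only: rev)
        also have "\<dots> = scale_h (*) c (pair_h w x) $ n"
          using fps_mult_assoc_lemma[of "\<lambda>i j l. c $ i * (w $ j) (x $ l)" n]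
          by (simp add: pair_h_nth[OF w] scale_h_def sum_distrib_left)
        finally show "pair_h w (scale_h s c x) $ n = scale_h (*) c (pair_h w x) $ n" .
      qed
    qed
  qed
  let ?w = "Abs_fps (\<lambda>n x. \<phi> (fps_const x) $ n)"
  have w: "?w \<in> dual_h s"
    using S.vector_space_axioms vector_space_field
    by (auto simp: dual_h_def dual_space_def Vector_Spaces.linear_iff \<phi>.add \<phi>.scale
        simp flip: fps_const_add const)
  have "pair_h ?w = \<phi>"
    using \<phi> by (intro K_linear_eqI[OF s vector_space_field hom[OF w]]) (auto simp: scale_h_field fps_eq_iff pc[OF w])
  moreover have "w = w'" if "w \<in> dual_h s" "w' \<in> dual_h s" "\<forall>v. pair_h w v = \<phi> v" "\<forall>v. pair_h w' v = \<phi> v" for w w'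
    using that pc[OF that(1)] pc[OF that(2)] by (simp add: fps_eq_iff fun_eq_iff)
  ultimately show ?thesis using w by (intro ex1I[of _ ?w]) auto
qed

context finite_dimensional_vector_space
begin

lemma representation_in_dual: "(\<lambda>x. representation Basis x e) \<in> dual_space scale"
  using vector_space_axioms vector_space_field
  by (simp add: dual_space_def Vector_Spaces.linear_iff representation_add representation_scale
      independent_Basis span_Basis)

lemma sum_representation: "(\<Sum>e\<in>Basis. scale (representation Basis x e) e) = x"
  by (rule sum_representation_eq) (auto simp: independent_Basis span_Basis finite_Basis)

lemma dual_apply_basis:
  assumes "u \<in> dual_space scale"
  shows "u x = (\<Sum>e\<in>Basis. representation Basis x e * u e)"
proof -
  interpret u: module_hom scale "(*)" u
    using assms by (simp add: dual_space_def Vector_Spaces.linear_def)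
  show ?thesis by (subst sum_representation[of x, symmetric]) (simp add: u.sum u.scale)
qed

lemma dual_expand:
  assumes "u \<in> dual_space scale"
  shows "u = (\<Sum>e\<in>Basis. fun_scale (u e) (\<lambda>x. representation Basis x e))"
proof
  have sum_apply: "(\<Sum>i\<in>I. f i) y = (\<Sum>i\<in>I. f i y)" for f :: "'b \<Rightarrow> 'b \<Rightarrow> 'a" and I y
    by (induction I rule: infinite_finite_induct) auto
  show "u x = (\<Sum>e\<in>Basis. fun_scale (u e) (\<lambda>x. representation Basis x e)) x" for x
    using dual_apply_basis[OF assms, of x] by (simp add: sum_apply fun_scale_def mult.commute)
qed

lemma dual_separates:
  assumes "\<And>u. u \<in> dual_space scale \<Longrightarrow> u x = u y"
  shows "x = y"
  using exists_dual_separating[OF vector_space_axioms, of x y] assms by blast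

lemma bidual_elem_ex1:
  assumes add: "\<And>u v. u \<in> dual_space scale \<Longrightarrow> v \<in> dual_space scale \<Longrightarrow> \<phi> (u + v) = \<phi> u + \<phi> v"
    and scl: "\<And>c u. u \<in> dual_space scale \<Longrightarrow> \<phi> (fun_scale c u) = c * \<phi> u"
  shows "\<exists>!v. \<forall>u\<in>dual_space scale. u v = \<phi> u"
proof -
  let ?r = "\<lambda>e x. representation Basis x e"
  have mem: "fun_scale c (?r e) \<in> dual_space scale" for c e
    using representation_in_dual[of e]
    by (auto simp: dual_space_def fun_scale_def Vector_Spaces.linear_iff algebra_simps)
  have mem0: "0 \<in> dual_space scale" and mem_add: "a \<in> dual_space scale \<Longrightarrow> b \<in> dual_space scale \<Longrightarrow> a + b \<in> dual_space scale" for a b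
    using vector_space_axioms vector_space_field
    by (auto simp: dual_space_def Vector_Spaces.linear_iff algebra_simps)
  have \<phi>_sum: "(\<Sum>e\<in>E. fun_scale (c e) (?r e)) \<in> dual_space scale \<and>
      \<phi> (\<Sum>e\<in>E. fun_scale (c e) (?r e)) = (\<Sum>e\<in>E. c e * \<phi> (?r e))" if "finite E" for c E
    using that
  proof induction
    case empty
    show ?case using scl[OF mem0, of 0] mem0 by (simp add: fun_scale_def zero_fun_def)
  next
    case (insert e E)
    have "fun_scale (c e) (?r e) + (\<Sum>e\<in>E. fun_scale (c e) (?r e)) \<in> dual_space scale \<and>
      \<phi> (fun_scale (c e) (?r e) + (\<Sum>e\<in>E. fun_scale (c e) (?r e))) =
      c e * \<phi> (?r e) + (\<Sum>e\<in>E. c e * \<phi> (?r e))"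
      by (simp only: insert.IH mem mem_add add scl[OF representation_in_dual] simp_thms)
    then show ?case by (simp only: sum.insert[OF insert.hyps])
  qed
  let ?v = "\<Sum>e\<in>Basis. scale (\<phi> (?r e)) e"
  have "u ?v = \<phi> u" if u: "u \<in> dual_space scale" for u
  proof -
    interpret u: module_hom scale "(*)" u
      using u by (simp add: dual_space_def Vector_Spaces.linear_def)
    have "\<phi> u = (\<Sum>e\<in>Basis. u e * \<phi> (?r e))"
      by (subst dual_expand[OF u]) (simp add: \<phi>_sum[OF finite_Basis])
    then show ?thesis by (simp add: u.sum u.scale mult.commute)
  qed
  moreover from this have "v = ?v" if "\<forall>u\<in>dual_space scale. u v = \<phi> u" for v
    using that by (intro dual_separates) metis
  ultimately show ?thesis by (intro ex1I[of _ ?v]) blast+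
qed

lemma bidual_h_elem_ex1:
  assumes add: "\<And>u v. u \<in> dual_h scale \<Longrightarrow> v \<in> dual_h scale \<Longrightarrow> \<phi> (u + v) = \<phi> u + \<phi> v"
    and scl: "\<And>c u. u \<in> dual_h scale \<Longrightarrow> \<phi> (scale_h fun_scale c u) = c * \<phi> u"
  shows "\<exists>!v. \<forall>u\<in>dual_h scale. pair_h u v = \<phi> u"
proof -
  let ?r = "\<lambda>e x. representation Basis x e"
  have mem0: "0 \<in> dual_space scale"
    and mem_add: "a \<in> dual_space scale \<Longrightarrow> b \<in> dual_space scale \<Longrightarrow> a + b \<in> dual_space scale"
    and mem_scale: "a \<in> dual_space scale \<Longrightarrow> fun_scale c a \<in> dual_space scale" for a b c
    using vector_space_axioms vector_space_field
    by (auto simp: dual_space_def Vector_Spaces.linear_iff fun_scale_def algebra_simps)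
  have nth: "scale_h fun_scale c (fps_const a) $ n = fun_scale (c $ n) a" for c and a :: "'b \<Rightarrow> 'a" and n
  proof -
    have "(\<Sum>i=0..n. fun_scale (c $ i) (fps_const a $ (n - i))) = (\<Sum>i=0..n. if i = n then fun_scale (c $ n) a else 0)"
      by (rule sum.cong) (auto simp: fun_scale_def fun_eq_iff)
    then show ?thesis by (simp add: scale_h_def)
  qed
  have memc: "fps_const (?r e) \<in> dual_h scale" for e
    using mem0 representation_in_dual by (auto simp: dual_h_def)
  have mem: "scale_h fun_scale c (fps_const (?r e)) \<in> dual_h scale" for c e
    using mem_scale[OF representation_in_dual] by (auto simp: dual_h_def nth)
  have \<phi>_sum: "(\<Sum>e\<in>E. scale_h fun_scale (c e) (fps_const (?r e))) \<in> dual_h scale \<and>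
      \<phi> (\<Sum>e\<in>E. scale_h fun_scale (c e) (fps_const (?r e))) = (\<Sum>e\<in>E. c e * \<phi> (fps_const (?r e)))"
    if "finite E" for c E
    using that
  proof induction
    case empty
    have mem0h: "0 \<in> dual_h scale" using mem0 by (simp add: dual_h_def)
    have "scale_h fun_scale 0 0 = (0 :: ('b \<Rightarrow> 'a) fps)"
      by (rule fps_ext) (simp add: scale_h_def fun_scale_def fun_eq_iff)
    then show ?case using scl[OF mem0h, of 0] mem0h by simp
  next
    case (insert e E)
    moreover have "a + b \<in> dual_h scale" if "a \<in> dual_h scale" "b \<in> dual_h scale" for a b
      using that mem_add by (simp add: dual_h_def)
    ultimately show ?case by (simp add: mem add scl memc)
  qed
  let ?v = "Abs_fps (\<lambda>n. \<Sum>e\<in>Basis. scale (\<phi> (fps_const (?r e)) $ n) e)"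
  have "pair_h u ?v = \<phi> u" if u: "u \<in> dual_h scale" for u
  proof -
    have un: "u $ n \<in> dual_space scale" for n using u by (simp add: dual_h_def)
    have "u = (\<Sum>e\<in>Basis. scale_h fun_scale (Abs_fps (\<lambda>n. (u $ n) e)) (fps_const (?r e)))"
      by (rule fps_ext) (subst dual_expand[OF un], simp add: fps_sum_nth nth)
    then have "\<phi> u = (\<Sum>e\<in>Basis. Abs_fps (\<lambda>n. (u $ n) e) * \<phi> (fps_const (?r e)))"
      using \<phi>_sum[OF finite_Basis, of "\<lambda>e. Abs_fps (\<lambda>n. (u $ n) e)"] by metis
    moreover have "pair_h u ?v $ n = (\<Sum>e\<in>Basis. Abs_fps (\<lambda>n. (u $ n) e) * \<phi> (fps_const (?r e))) $ n" for n
    proof -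
      have "(u $ i) (\<Sum>e\<in>Basis. scale (c e) e) = (\<Sum>e\<in>Basis. (u $ i) e * c e)" for i c
      proof -
        interpret ui: module_hom scale "(*)" "u $ i"
          using un[of i] by (simp add: dual_space_def Vector_Spaces.linear_def)
        show ?thesis by (simp add: ui.sum ui.scale mult.commute)
      qed
      then show ?thesis
        by (simp add: pair_h_nth[OF u] fps_sum_nth fps_mult_nth sum.swap[of _ Basis])
    qed
    ultimately show ?thesis by (simp add: fps_eq_iff)
  qed
  moreover have "v = v'" if eq: "\<And>u. u \<in> dual_h scale \<Longrightarrow> pair_h u v = pair_h u v'" for v v'
  proof (rule fps_ext, rule dual_separates)
    fix n a assume a: "a \<in> dual_space scale"
    then have m: "fps_const a \<in> dual_h scale" using mem0 by (simp add: dual_h_def)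
    have "pair_h (fps_const a) w $ n = a (w $ n)" for w
    proof -
      have "(\<Sum>i=0..n. (fps_const a $ i) (w $ (n - i))) = (\<Sum>i=0..n. if i = 0 then a (w $ n) else 0)"
        by (rule sum.cong) auto
      then show ?thesis by (simp add: pair_h_nth[OF m])
    qed
    then show "a (v $ n) = a (v' $ n)" using eq[OF m] by metis
  qed
  ultimately show ?thesis by (intro ex1I[of _ ?v]) auto
qed

end


section \<open>Matched pairs\<close>

text \<open>The operations and actions of a matched pair \<open>((A, op1), (B, op2), l1, r1, l2, r2)\<close>.
  The same record serves for \<open>A\<close>, \<open>B\<close> over the field and for \<open>A[[h]]\<close>, \<open>B[[h]]\<close>. When \<open>B\<close> is
  a proper subset of its type, as for \<open>B = A\<^sup>*\<close>, only the values on \<open>B\<close> are meaningful.\<close>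

record ('a, 'b) matched_pair_data =
  op1 :: "'a \<Rightarrow> 'a \<Rightarrow> 'a"
  op2 :: "'b \<Rightarrow> 'b \<Rightarrow> 'b"
  l1 :: "'a \<Rightarrow> 'b \<Rightarrow> 'b"
  r1 :: "'a \<Rightarrow> 'b \<Rightarrow> 'b"
  l2 :: "'b \<Rightarrow> 'a \<Rightarrow> 'a"
  r2 :: "'b \<Rightarrow> 'a \<Rightarrow> 'a"

definition matched_pairs_coincide ::
  "'a set \<Rightarrow> 'b set \<Rightarrow> ('a, 'b) matched_pair_data \<Rightarrow> ('a, 'b) matched_pair_data \<Rightarrow> bool" where
  "matched_pairs_coincide A B M N \<longleftrightarrow>
     (\<forall>x\<in>A. \<forall>y\<in>A. op1 M x y = op1 N x y) \<and>
     (\<forall>u\<in>B. \<forall>v\<in>B. op2 M u v = op2 N u v) \<and>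
     (\<forall>x\<in>A. \<forall>v\<in>B. l1 M x v = l1 N x v) \<and>
     (\<forall>x\<in>A. \<forall>v\<in>B. r1 M x v = r1 N x v) \<and>
     (\<forall>v\<in>B. \<forall>x\<in>A. l2 M v x = l2 N v x) \<and>
     (\<forall>v\<in>B. \<forall>x\<in>A. r2 M v x = r2 N v x)"

text \<open>The bilinear extension of \<open>(x, y) \<mapsto> \<Sum>\<^sub>n b (D x) (E y) h\<^sup>n / n!\<close> with \<open>n\<close>-th iterates of \<open>D\<close>, \<open>E\<close>.\<close>

definition deform ::
  "('k::field_char_0 \<Rightarrow> 'w::ab_group_add \<Rightarrow> 'w) \<Rightarrow> ('u \<Rightarrow> 'u) \<Rightarrow> ('v \<Rightarrow> 'v) \<Rightarrow> ('u \<Rightarrow> 'v \<Rightarrow> 'w) \<Rightarrow>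
   'u fps \<Rightarrow> 'v fps \<Rightarrow> 'w fps" where
  "deform s D E b = ext2_h (\<lambda>x y. exp_series s (\<lambda>n. b ((D ^^ n) x) ((E ^^ n) y)))"

definition restrict1 :: "('a \<times> 'b::zero \<Rightarrow> 'a \<times> 'b) \<Rightarrow> 'a \<Rightarrow> 'a" where
  "restrict1 D x = fst (D (x, 0))"

definition restrict2 :: "('a::zero \<times> 'b \<Rightarrow> 'a \<times> 'b) \<Rightarrow> 'b \<Rightarrow> 'b" where
  "restrict2 D v = snd (D (0, v))"

text \<open>The deformation of a matched pair induced by commuting derivations \<open>D1\<close>, \<open>D2\<close> of the
  matched pair algebra on \<open>A \<times> B\<close> that preserve \<open>A\<close> and \<open>B\<close>. Note the exchanged roles
  of \<open>D1\<close> and \<open>D2\<close> in the right actions.\<close>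

definition matched_pair_deformation ::
  "('k::field_char_0 \<Rightarrow> 'a::ab_group_add \<Rightarrow> 'a) \<Rightarrow> ('k \<Rightarrow> 'b::ab_group_add \<Rightarrow> 'b) \<Rightarrow>
   ('a, 'b) matched_pair_data \<Rightarrow> ('a \<times> 'b \<Rightarrow> 'a \<times> 'b) \<Rightarrow> ('a \<times> 'b \<Rightarrow> 'a \<times> 'b) \<Rightarrow>
   ('a fps, 'b fps) matched_pair_data" where
  "matched_pair_deformation sA sB M D1 D2 =
     \<lparr> op1 = deform sA (restrict1 D1) (restrict1 D2) (op1 M),
       op2 = deform sB (restrict2 D1) (restrict2 D2) (op2 M),
       l1 = deform sB (restrict1 D1) (restrict2 D2) (l1 M),
       r1 = deform sB (restrict1 D2) (restrict2 D1) (r1 M),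
       l2 = deform sA (restrict2 D1) (restrict1 D2) (l2 M),
       r2 = deform sA (restrict2 D2) (restrict1 D1) (r2 M) \<rparr>"


section \<open>Matched pairs from ASI bialgebras\<close>

text \<open>In both constructions the components \<open>l1\<close>, \<open>r1\<close>, \<open>l2\<close>, \<open>r2\<close> are the transposes of the right
  and left multiplications of \<open>A\<close>, and of the right and left multiplications of its dual; e.g.
  \<open>l2 a x\<close> is the element with \<open>\<langle>b, l2 a x\<rangle> = \<langle>b \<cdot> a, x\<rangle>\<close> for all \<open>b\<close> in the dual.\<close>

definition dual_op ::
  "('a \<Rightarrow> ('a, 'a, 'k::field) tensor) \<Rightarrow> ('a \<Rightarrow> 'k) \<Rightarrow> ('a \<Rightarrow> 'k) \<Rightarrow> ('a \<Rightarrow> 'k)" where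
  "dual_op \<Delta> a b = (\<lambda>x. dual_tens a b (\<Delta> x))"

definition asi_matched_pair ::
  "('k::field \<Rightarrow> 'a::ab_group_add \<Rightarrow> 'a) \<Rightarrow> ('a \<Rightarrow> 'a \<Rightarrow> 'a) \<Rightarrow> ('a \<Rightarrow> ('a, 'a, 'k) tensor) \<Rightarrow>
   ('a, 'a \<Rightarrow> 'k) matched_pair_data" where
  "asi_matched_pair s m \<Delta> = (let L = (\<lambda>x y. m x y); R = (\<lambda>x y. m y x); dm = dual_op \<Delta> in
     \<lparr> op1 = m,
       op2 = dm,
       l1 = (\<lambda>x. transpose_map (R x)),
       r1 = (\<lambda>x. transpose_map (L x)),
       l2 = (\<lambda>a x. bidual_elem s (\<lambda>b. (dm b a) x)),
       r2 = (\<lambda>a x. bidual_elem s (\<lambda>b. (dm a b) x)) \<rparr>)"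

definition deform_comult ::
  "('k::field_char_0 \<Rightarrow> 'a::ab_group_add \<Rightarrow> 'a) \<Rightarrow> ('a \<Rightarrow> 'a) \<Rightarrow> ('a \<Rightarrow> 'a) \<Rightarrow>
   ('a \<Rightarrow> ('a, 'a, 'k) tensor) \<Rightarrow> 'a fps \<Rightarrow> ('a, 'a, 'k) tensor fps" where
  "deform_comult s p1 p2 \<Delta> =
     ext_h (\<lambda>x. exp_series fun_scale (\<lambda>n. tensor_map s s (p1 ^^ n) (p2 ^^ n) (\<Delta> x)))"

definition dual_op_h ::
  "('k::field \<Rightarrow> 'a::ab_group_add \<Rightarrow> 'a) \<Rightarrow> ('a fps \<Rightarrow> ('a, 'a, 'k) tensor fps) \<Rightarrow>
   ('a \<Rightarrow> 'k) fps \<Rightarrow> ('a \<Rightarrow> 'k) fps \<Rightarrow> ('a \<Rightarrow> 'k) fps" where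
  "dual_op_h s \<Delta>h a b = dual_h_elem s (\<lambda>x. pair_h (dual_tens_h a b) (\<Delta>h x))"

definition asi_matched_pair_h ::
  "('k::field \<Rightarrow> 'a::ab_group_add \<Rightarrow> 'a) \<Rightarrow> ('a fps \<Rightarrow> 'a fps \<Rightarrow> 'a fps) \<Rightarrow>
   ('a fps \<Rightarrow> ('a, 'a, 'k) tensor fps) \<Rightarrow> ('a fps, ('a \<Rightarrow> 'k) fps) matched_pair_data" where
  "asi_matched_pair_h s mh \<Delta>h =
    (let L = (\<lambda>x y. mh x y); R = (\<lambda>x y. mh y x); dmh = dual_op_h s \<Delta>h in
     \<lparr> op1 = mh,
       op2 = dmh,
       l1 = (\<lambda>x u. dual_h_elem s (\<lambda>y. pair_h u (R x y))),
       r1 = (\<lambda>x u. dual_h_elem s (\<lambda>y. pair_h u (L x y))),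
       l2 = (\<lambda>a x. bidual_h_elem s (\<lambda>b. pair_h (dmh b a) x)),
       r2 = (\<lambda>a x. bidual_h_elem s (\<lambda>b. pair_h (dmh a b) x)) \<rparr>)"

end

theory Submission
  imports Defs
begin

text \<open>Apart from the product of the algebra, which is the same deformation of \<open>m\<close> in both pairs,
  every component of the pair corresponding to the deformed bialgebra takes as value the unique
  element with prescribed pairings, so it suffices to compute those pairings for the corresponding component
  of the deformed matched pair. The coefficient of \<open>h\<^sup>n\<close> in either pairing is a sum over the ways of
  writing \<open>n\<close> as a sum of four exponents, one for each of the three series involved and one for the
  exponential series of the deformation (\<open>pair_h_deform_left\<close>, \<open>pair_h_deform_right\<close>). Hence the
  pairings agree as soon as the terms of order \<open>k\<close> in the exponential series do.

  For the products on the dual the terms agree because \<open>\<langle>a \<otimes> b, (p1\<^sup>k \<otimes> p2\<^sup>k) \<Delta>(x)\<rangle>\<close> is the dual product of the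
  transposes of \<open>p1\<^sup>k\<close> and \<open>p2\<^sup>k\<close> applied to \<open>a\<close> and \<open>b\<close> (\<open>dual_op_h_deform_comult\<close>). For the four
  actions they agree by the four iterated identities
  \<open>d1\<^sup>k(x) \<circ> d2\<^sup>k(y) = p2\<^sup>k(x \<circ> d1\<^sup>k(y))\<close>, \<open>d1\<^sup>k(x) \<circ> d2\<^sup>k(y) = p1\<^sup>k(d2\<^sup>k(x) \<circ> y)\<close>,
  \<open>(p1\<^sup>k \<otimes> p2\<^sup>k)\<Delta> = (id \<otimes> p1\<^sup>k)\<Delta> d2\<^sup>k\<close> and \<open>(p1\<^sup>k \<otimes> p2\<^sup>k)\<Delta> = (p2\<^sup>k \<otimes> id)\<Delta> d1\<^sup>k\<close>.
  The hypotheses are the case \<open>k = 1\<close>. In terms of the dual product, the conditions on \<open>\<Delta>\<close> have the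
  same shape as those on \<open>m\<close>, with the roles of \<open>d\<close> and \<open>p\<close> exchanged by transposition, so a single
  induction (\<open>intertwine_funpow\<close>) covers all four.\<close>

section \<open>Coefficients of pairings\<close>

text \<open>Summing over index quadruples, instead of over nested intervals, makes
  every exchange of the roles of the three series a bijection of the index set.\<close>

definition quads :: "nat \<Rightarrow> (nat \<times> nat \<times> nat \<times> nat) set" where
  "quads n = {(i, j, l, k). i + j + l + k = n}"

lemma sum_quads:
  fixes F :: "nat \<Rightarrow> nat \<Rightarrow> nat \<Rightarrow> nat \<Rightarrow> 'b::comm_monoid_add"
  shows "(\<Sum>i=0..n. \<Sum>j=0..n-i. \<Sum>l=0..n-i-j. F i j l (n-i-j-l)) = (\<Sum>(i,j,l,k)\<in>quads n. F i j l k)"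
  by (simp add: sum.Sigma)
    (rule sum.reindex_bij_witness[where j = "\<lambda>(i,j,l). (i, j, l, n-i-j-l)" and i = "\<lambda>(i,j,l,k). (i,j,l)"],
      auto simp: quads_def)

lemma ext2_h_fps_const_nth:
  "ext2_h (\<lambda>x y. fps_const (b x y)) u v $ n = (\<Sum>i=0..n. b (u $ i) (v $ (n - i)))"
proof -
  have "(\<Sum>i=0..k. fps_const (b x (v $ i)) $ (k - i)) = b x (v $ k)" for x k
  proof -
    have "(\<Sum>i=0..k. fps_const (b x (v $ i)) $ (k - i)) = (\<Sum>i=0..k. if i = k then b x (v $ k) else 0)"
      by (rule sum.cong) auto
    then show ?thesis by simp
  qed
  then show ?thesis by (simp add: ext2_h_def ext_h_def)
qed

lemma pair_h_coeff: "pair_h u v $ n = (\<Sum>i=0..n. (u $ i) (v $ (n - i)))"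
  unfolding pair_h_def by (rule ext2_h_fps_const_nth)

lemma dual_tens_h_coeff: "dual_tens_h a b $ n = (\<Sum>i=0..n. dual_tens (a $ i) (b $ (n - i)))"
  unfolding dual_tens_h_def by (rule ext2_h_fps_const_nth)

lemma deform_coeff:
  "deform s D E b u v $ n = (\<Sum>i=0..n. \<Sum>j=0..n-i.
     s (1 / fact (n-i-j)) (b ((D ^^ (n-i-j)) (u $ i)) ((E ^^ (n-i-j)) (v $ j))))"
  by (simp add: deform_def ext2_h_def ext_h_def exp_series_def)

lemma sum_fun_apply: "(\<Sum>i\<in>I. f i) y = (\<Sum>i\<in>I. f i y)"
  by (induction I rule: infinite_finite_induct) auto

text \<open>Functionals are added pointwise, so evaluation at a coefficient of \<open>y\<close> passes through the sums
  that make up the deformation. The last index \<open>k\<close> is the order in the exponential series.\<close>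

lemma pair_h_deform_left:
  "pair_h (deform fun_scale D E b u v) y $ n =
     (\<Sum>(i,j,l,k)\<in>quads n. 1 / fact k * b ((D ^^ k) (u $ i)) ((E ^^ k) (v $ j)) (y $ l))"
proof -
  let ?F = "\<lambda>i j k l. 1 / fact k * b ((D ^^ k) (u $ i)) ((E ^^ k) (v $ j)) (y $ l)"
  have "pair_h (deform fun_scale D E b u v) y $ n =
      (\<Sum>a=0..n. \<Sum>i=0..a. \<Sum>j=0..a-i. ?F i j (a-i-j) (n-a))"
    by (simp add: pair_h_coeff deform_coeff sum_fun_apply fun_scale_def)
  also have "\<dots> = (\<Sum>i=0..n. \<Sum>c=0..n-i. \<Sum>j=0..c. ?F i j (c-j) (n-i-c))"
    by (rule fps_mult_assoc_lemma[of "\<lambda>i c l. \<Sum>j=0..c. ?F i j (c-j) l"])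
  also have "\<dots> = (\<Sum>i=0..n. \<Sum>j=0..n-i. \<Sum>k=0..n-i-j. ?F i j k (n-i-j-k))"
    by (intro sum.cong refl fps_mult_assoc_lemma)
  also have "\<dots> = (\<Sum>(i,j,k,l)\<in>quads n. ?F i j k l)"
    by (rule sum_quads)
  also have "\<dots> = (\<Sum>(i,j,l,k)\<in>quads n. ?F i j k l)"
    by (rule sum.reindex_bij_witness[where i = "\<lambda>(i,j,l,k). (i,j,k,l)" and j = "\<lambda>(i,j,l,k). (i,j,k,l)"])
      (auto simp: quads_def)
  finally show ?thesis .
qed

lemma dual_spaceD:
  assumes "u \<in> dual_space s"
  shows "u (x + y) = u x + u y" "u (s c x) = c * u x" "u 0 = 0" "u (\<Sum>i\<in>I. f i) = (\<Sum>i\<in>I. u (f i))"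
proof -
  interpret u: module_hom s "(*)" u
    using assms by (simp add: dual_space_def Vector_Spaces.linear_def)
  show "u (x + y) = u x + u y" "u (s c x) = c * u x" "u 0 = 0" "u (\<Sum>i\<in>I. f i) = (\<Sum>i\<in>I. u (f i))"
    by (fact u.add u.scale u.zero u.sum)+
qed

text \<open>With the deformed operation in the second argument, it is the linearity of the coefficients
  of \<open>w\<close> that moves them past the sums and the factorials.\<close>

lemma pair_h_deform_right:
  assumes "w \<in> dual_h s"
  shows "pair_h w (deform s D E b u v) $ n =
     (\<Sum>(l,i,j,k)\<in>quads n. 1 / fact k * (w $ l) (b ((D ^^ k) (u $ i)) ((E ^^ k) (v $ j))))"
proof -
  have "w $ l \<in> dual_space s" for l using assms by (simp add: dual_h_def)
  note lin = dual_spaceD[OF this]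
  show ?thesis
    unfolding pair_h_coeff deform_coeff lin
    by (rule sum_quads[of "\<lambda>l i j k. 1 / fact k * (w $ l) (b ((D ^^ k) (u $ i)) ((E ^^ k) (v $ j)))"])
qed

section \<open>Elements determined by their pairings\<close>

text \<open>The pairings with constant series already determine all coefficients.\<close>

lemma dual_h_elem_eqI:
  assumes w: "w \<in> dual_h s" and pair: "\<And>v. pair_h w v = \<phi> v"
  shows "dual_h_elem s \<phi> = w"
  unfolding dual_h_elem_def
proof (rule the_equality)
  have const: "pair_h w (fps_const x) $ n = (w $ n) x" if "w \<in> dual_h s" for w x n
  proof -
    have "(w $ i) 0 = 0" for i using that dual_spaceD(3) by (auto simp: dual_h_def)
    then have "pair_h w (fps_const x) $ n = (\<Sum>i=0..n. if i = n then (w $ n) x else 0)"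
      unfolding pair_h_coeff by (intro sum.cong) auto
    then show ?thesis by simp
  qed
  show "w' = w" if "w' \<in> dual_h s \<and> (\<forall>v. pair_h w' v = \<phi> v)" for w'
    using that w pair by (intro fps_ext ext) (metis const)
qed (use assms in auto)

lemma bidual_h_elem_eqI:
  assumes vs: "vector_space s" and pair: "\<And>u. u \<in> dual_h s \<Longrightarrow> pair_h u v = \<phi> u"
  shows "bidual_h_elem s \<phi> = v"
  unfolding bidual_h_elem_def
proof (rule the_equality)
  fix v' assume v': "\<forall>u\<in>dual_h s. pair_h u v' = \<phi> u"
  have "v' $ n = v $ n" for n
  proof (rule ccontr)
    assume "v' $ n \<noteq> v $ n"
    then obtain a where a: "a \<in> dual_space s" "a (v' $ n) \<noteq> a (v $ n)"
      using exists_dual_separating[OF vs] by blast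
    have "0 \<in> dual_space s"
      using vs vector_space_field by (simp add: dual_space_def Vector_Spaces.linear_iff)
    with a(1) have mem: "fps_const a \<in> dual_h s" by (simp add: dual_h_def)
    have "pair_h (fps_const a) z $ n = a (z $ n)" for z
    proof -
      have "pair_h (fps_const a) z $ n = (\<Sum>i=0..n. if i = 0 then a (z $ n) else 0)"
        unfolding pair_h_coeff by (intro sum.cong) auto
      then show ?thesis by simp
    qed
    then show False using a(2) v' pair mem by metis
  qed
  then show "v' = v" by (simp add: fps_eq_iff)
qed (use pair in auto)

lemma bidual_elem_pair:
  assumes "finite_dimensional_vector_space s Basis"
    and "\<And>u v. u \<in> dual_space s \<Longrightarrow> v \<in> dual_space s \<Longrightarrow> \<phi> (u + v) = \<phi> u + \<phi> v"
    and "\<And>c u. u \<in> dual_space s \<Longrightarrow> \<phi> (fun_scale c u) = c * \<phi> u"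
    and "u \<in> dual_space s"
  shows "u (bidual_elem s \<phi>) = \<phi> u"
  using theI'[OF finite_dimensional_vector_space.bidual_elem_ex1[OF assms(1-3)]] assms(4)
  unfolding bidual_elem_def by blast

section \<open>Transposes and the dual operation\<close>

lemma transpose_map_funpow:
  fixes f :: "'a \<Rightarrow> 'a"
  shows "(transpose_map f ^^ k) u = transpose_map (f ^^ k) u"
  proof (induction k)
  case (Suc k)
  then have "(transpose_map f ^^ Suc k) u = transpose_map f (transpose_map (f ^^ k) u)"
    by simp
  also have "\<dots> = transpose_map (f ^^ Suc k) u"
    by (simp only: transpose_map_def funpow_Suc_right o_apply)
  finally show ?case .
qed (simp add: transpose_map_def)

lemma transpose_map_dual:
  assumes "Vector_Spaces.linear s t f" "u \<in> dual_space t"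
  shows "transpose_map f u \<in> dual_space s"
  using assms by (simp add: dual_space_def transpose_map_def Vector_Spaces.linear_iff)

lemma linear_funpow:
  assumes "Vector_Spaces.linear s s f"
  shows "Vector_Spaces.linear s s (f ^^ k)"
  using assms by (induction k) (auto simp: Vector_Spaces.linear_iff)

lemma deform_in_dual_h:
  assumes vs: "vector_space s"
    and b: "\<And>i j k. b ((D ^^ k) (u $ i)) ((E ^^ k) (v $ j)) \<in> dual_space s"
  shows "deform fun_scale D E b u v \<in> dual_h s"
proof -
  have sum: "(\<Sum>i\<in>I. f i) \<in> dual_space s" if "\<And>i. i \<in> I \<Longrightarrow> f i \<in> dual_space s"
    for I :: "nat set" and f
    using that
    by (induction I rule: infinite_finite_induct)
      (use vs vector_space_field in \<open>auto simp: dual_space_def Vector_Spaces.linear_iff algebra_simps\<close>)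
  have scale: "fun_scale c a \<in> dual_space s" if "a \<in> dual_space s" for c a
    using that by (simp add: dual_space_def Vector_Spaces.linear_iff fun_scale_def algebra_simps)
  show ?thesis
    by (auto simp: dual_h_def deform_coeff intro!: sum scale b)
qed

lemma dual_op_dual:
  assumes "Vector_Spaces.linear s fun_scale \<Delta>"
  shows "dual_op \<Delta> a b \<in> dual_space s"
  using transpose_map_dual[OF assms, of "dual_tens a b"] linear_dual_tens[of a b]
  by (simp add: dual_space_def transpose_map_def dual_op_def)

lemma bilinear_form_dual:
  assumes "a \<in> dual_space s1" "b \<in> dual_space s2"
  shows "bilinear_form s1 s2 (\<lambda>x y. a x * b y)"
  using assms by (simp add: dual_space_def bilinear_map_def Vector_Spaces.linear_iff algebra_simps)

text \<open>This turns identities between tensors into identities for the dual operation.\<close>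

lemma dual_tens_tensor_map:
  assumes "a \<in> dual_space t1" "b \<in> dual_space t2"
  shows "dual_tens a b (tensor_map t1 t2 f g t) = dual_tens (transpose_map f a) (transpose_map g b) t"
  using bilinear_form_dual[OF assms] by (simp add: dual_tens_def tensor_map_def transpose_map_def)

lemma dual_op_add:
  assumes vs: "vector_space s" and \<Delta>: "\<Delta> x \<in> tensor_space s s"
    and a: "a \<in> dual_space s" and b: "b \<in> dual_space s" and c: "c \<in> dual_space s"
  shows "dual_op \<Delta> (a + b) c x = dual_op \<Delta> a c x + dual_op \<Delta> b c x"
    and "dual_op \<Delta> c (a + b) x = dual_op \<Delta> c a x + dual_op \<Delta> c b x"
  using tensor_space_add_scale(1)[OF \<Delta> vs vs bilinear_form_dual[OF a c] bilinear_form_dual[OF b c]]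
    tensor_space_add_scale(1)[OF \<Delta> vs vs bilinear_form_dual[OF c a] bilinear_form_dual[OF c b]]
  by (simp_all add: dual_op_def dual_tens_def algebra_simps)

lemma dual_op_scale:
  assumes vs: "vector_space s" and \<Delta>: "\<Delta> x \<in> tensor_space s s"
    and a: "a \<in> dual_space s" and c: "c \<in> dual_space s"
  shows "dual_op \<Delta> (fun_scale r a) c x = r * dual_op \<Delta> a c x"
    and "dual_op \<Delta> c (fun_scale r a) x = r * dual_op \<Delta> c a x"
  using tensor_space_add_scale(2)[OF \<Delta> vs vs bilinear_form_dual[OF a c] bilinear_form_dual[OF a c], of r]
    tensor_space_add_scale(2)[OF \<Delta> vs vs bilinear_form_dual[OF c a] bilinear_form_dual[OF c a], of r]
  by (simp_all add: dual_op_def dual_tens_def fun_scale_def algebra_simps)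

text \<open>Dualising commutes with deforming: the operator \<open>p1\<^sup>k \<otimes> p2\<^sup>k\<close> in the order \<open>k\<close> term
  of the deformed comultiplication moves to the functionals as a pair of transposes.\<close>

lemma dual_op_h_deform_comult:
  fixes s :: "'k::field_char_0 \<Rightarrow> 'a::ab_group_add \<Rightarrow> 'a"
  assumes vs: "vector_space s" and \<Delta>: "Vector_Spaces.linear s fun_scale \<Delta>"
    and a: "a \<in> dual_h s" and b: "b \<in> dual_h s"
  shows "dual_op_h s (deform_comult s p1 p2 \<Delta>) a b =
    deform fun_scale (transpose_map p1) (transpose_map p2) (dual_op \<Delta>) a b"
  unfolding dual_op_h_def
proof (rule dual_h_elem_eqI[OF deform_in_dual_h[OF vs dual_op_dual[OF \<Delta>]]], rule fps_ext)
  fix x n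
  let ?F = "\<lambda>i j l k. 1 / fact k *
    dual_op \<Delta> ((transpose_map p1 ^^ k) (a $ i)) ((transpose_map p2 ^^ k) (b $ j)) (x $ l)"
  have ab: "a $ i \<in> dual_space s" "b $ i \<in> dual_space s" for i
    using a b by (auto simp: dual_h_def)
  have dt: "dual_tens f g \<in> dual_space fun_scale" for f g :: "'a \<Rightarrow> 'k"
    using linear_dual_tens by (simp add: dual_space_def)
  have coeff: "dual_tens (a $ i) (b $ j) (deform_comult s p1 p2 \<Delta> x $ c) = (\<Sum>l=0..c. ?F i j l (c - l))"
    for i j c
    by (simp add: deform_comult_def ext_h_def exp_series_def dual_spaceD[OF dt]
        dual_tens_tensor_map[OF ab] transpose_map_funpow dual_op_def)
  have "pair_h (dual_tens_h a b) (deform_comult s p1 p2 \<Delta> x) $ n =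
      (\<Sum>c=0..n. \<Sum>i=0..c. \<Sum>l=0..n-c. ?F i (c-i) l (n-c-l))"
    by (simp add: pair_h_coeff dual_tens_h_coeff sum_fun_apply coeff)
  also have "\<dots> = (\<Sum>i=0..n. \<Sum>j=0..n-i. \<Sum>l=0..n-i-j. ?F i j l (n-i-j-l))"
    by (rule fps_mult_assoc_lemma[of "\<lambda>i j c. \<Sum>l=0..c. ?F i j l (c-l)"])
  also have "\<dots> = (\<Sum>(i,j,l,k)\<in>quads n. ?F i j l k)"
    by (rule sum_quads)
  finally show "pair_h (deform fun_scale (transpose_map p1) (transpose_map p2) (dual_op \<Delta>) a b) x $ n =
      pair_h (dual_tens_h a b) (deform_comult s p1 p2 \<Delta> x) $ n"
    by (simp only: pair_h_deform_left)
qed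

section \<open>Iterating the compatibility conditions\<close>

text \<open>Peel off the outermost \<open>D\<close> and \<open>E\<close>, which yields one \<open>P\<close> and one \<open>D'\<close>; the latter is moved
  inwards past the remaining powers of \<open>E\<close> to the argument \<open>y\<close>, which is why the induction
  generalises over \<open>y\<close>. The sets \<open>X\<close> and \<open>Y\<close> are there for the dual operation, where the
  identity holds for linear functionals only. The conditions that move an operator to the first
  argument are obtained by exchanging the arguments of \<open>B\<close>.\<close>

lemma intertwine_funpow:
  assumes B: "\<And>x y. x \<in> X \<Longrightarrow> y \<in> Y \<Longrightarrow> B (D x) (E y) = P (B x (D' y))"
    and maps: "\<And>x. x \<in> X \<Longrightarrow> D x \<in> X" "\<And>y. y \<in> Y \<Longrightarrow> E y \<in> Y" "\<And>y. y \<in> Y \<Longrightarrow> D' y \<in> Y"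
    and comm: "\<And>y. D' (E y) = E (D' y)"
    and "x \<in> X" "y \<in> Y"
  shows "B ((D ^^ k) x) ((E ^^ k) y) = (P ^^ k) (B x ((D' ^^ k) y))"
  using \<open>y \<in> Y\<close>
proof (induction k arbitrary: y)
  case (Suc k)
  have X: "(D ^^ k) x \<in> X" by (induction k) (auto simp: maps \<open>x \<in> X\<close>)
  have Y: "(E ^^ k) y \<in> Y" by (induction k) (auto simp: maps Suc.prems)
  have swap: "D' ((E ^^ k) y) = (E ^^ k) (D' y)" by (induction k) (auto simp: comm)
  have "B ((D ^^ Suc k) x) ((E ^^ Suc k) y) = P (B ((D ^^ k) x) ((E ^^ k) (D' y)))"
    using B[OF X Y] by (simp add: swap)
  also have "\<dots> = (P ^^ Suc k) (B x ((D' ^^ Suc k) y))"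
    using Suc.IH[OF maps(3)[OF Suc.prems]] by (simp add: funpow_swap1)
  finally show ?case .
qed simp

section \<open>The two matched pairs\<close>

theorem proposition3p19:
  fixes scale :: "'k::field_char_0 \<Rightarrow> 'a::ab_group_add \<Rightarrow> 'a"
    and Basis :: "'a set"
    and m :: "'a \<Rightarrow> 'a \<Rightarrow> 'a"
    and \<Delta> :: "'a \<Rightarrow> ('a, 'a, 'k) tensor"
    and d1 d2 p1 p2 :: "'a \<Rightarrow> 'a"
  assumes "finite_dimensional_vector_space scale Basis"
    and "asi_bialgebra scale m \<Delta>"
    and "coherent_derivation scale m \<Delta> d1 p1"
    and "coherent_derivation scale m \<Delta> d2 p2"
    and "\<And>x. d1 (d2 x) = d2 (d1 x)"
    and "\<And>x. p1 (p2 x) = p2 (p1 x)"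
    and "\<And>x y. m (d1 x) (d2 y) = p2 (m x (d1 y))"
    and "\<And>x y. m (d1 x) (d2 y) = p1 (m (d2 x) y)"
    and "\<And>x. tensor_map scale scale p1 p2 (\<Delta> x) = tensor_map scale scale id p1 (\<Delta> (d2 x))"
    and "\<And>x. tensor_map scale scale p1 p2 (\<Delta> x) = tensor_map scale scale p2 id (\<Delta> (d1 x))"
  shows "matched_pairs_coincide UNIV (dual_h scale)
           (asi_matched_pair_h scale (deform scale d1 d2 m) (deform_comult scale p1 p2 \<Delta>))
           (matched_pair_deformation scale fun_scale (asi_matched_pair scale m \<Delta>)
              (map_prod d1 (transpose_map p1)) (map_prod d2 (transpose_map p2)))"
proof -
  let ?p1 = "transpose_map p1" and ?p2 = "transpose_map p2"
  let ?d1 = "transpose_map d1" and ?d2 = "transpose_map d2"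
  interpret finite_dimensional_vector_space scale Basis by fact
  note vs = vector_space_axioms
  have bil: "bilinear_map scale scale scale m"
    and lin\<Delta>: "Vector_Spaces.linear scale fun_scale \<Delta>" and ran\<Delta>: "\<Delta> x \<in> tensor_space scale scale" for x
    using assms(2) by (auto simp: asi_bialgebra_def assoc_algebra_def coassoc_coalgebra_def)
  have mlin: "Vector_Spaces.linear scale scale (m x)" "Vector_Spaces.linear scale scale (\<lambda>x. m x y)" for x y
    using bil by (auto simp: bilinear_map_def)
  have plin: "Vector_Spaces.linear scale scale p1" "Vector_Spaces.linear scale scale p2"
    using assms(3,4) by (auto simp: coherent_derivation_def coderivation_def)
  have coeff: "u $ i \<in> dual_space scale" if "u \<in> dual_h scale" for u i
    using that by (simp add: dual_h_def)
  have pk: "(?p1 ^^ k) u \<in> dual_space scale" "(?p2 ^^ k) u \<in> dual_space scale"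
    if "u \<in> dual_space scale" for u k
    using that by (auto simp: transpose_map_funpow intro: transpose_map_dual linear_funpow plin)
  have commd: "d2 (d1 x) = d1 (d2 x)" for x by (simp add: assms(5))
  have commp: "?p1 (?p2 u) = ?p2 (?p1 u)" for u by (simp add: transpose_map_def assms(6))

  \<comment> \<open>The iterated conditions, each named after the action that it serves.\<close>
  have it_l1: "m ((d1 ^^ k) x) ((d2 ^^ k) y) = (p2 ^^ k) (m x ((d1 ^^ k) y))" for k x y
    by (rule intertwine_funpow[of UNIV UNIV]) (auto simp: assms(5,7))
  have it_r1: "m ((d1 ^^ k) x) ((d2 ^^ k) y) = (p1 ^^ k) (m ((d2 ^^ k) x) y)" for k x y
    by (rule intertwine_funpow[of UNIV UNIV "\<lambda>y x. m x y"]) (auto simp: commd assms(8))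
  have it_l2: "dual_op \<Delta> ((?p1 ^^ k) a) ((?p2 ^^ k) b) x = dual_op \<Delta> a ((?p1 ^^ k) b) ((d2 ^^ k) x)"
    if "a \<in> dual_space scale" "b \<in> dual_space scale" for k a b x
  proof -
    have "dual_op \<Delta> (?p1 a) (?p2 b) = ?d2 (dual_op \<Delta> a (?p1 b))"
      if "a \<in> dual_space scale" "b \<in> dual_space scale" for a b
      using arg_cong[OF assms(9), of "dual_tens a b"]
      by (auto simp: dual_tens_tensor_map[OF that] dual_op_def transpose_map_def)
    then have "dual_op \<Delta> ((?p1 ^^ k) a) ((?p2 ^^ k) b) = (?d2 ^^ k) (dual_op \<Delta> a ((?p1 ^^ k) b))"
      by (intro intertwine_funpow[of "dual_space scale" "dual_space scale"])
        (auto simp: commp that intro: transpose_map_dual plin)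
    then show ?thesis by (simp add: transpose_map_funpow) (simp add: transpose_map_def)
  qed
  have it_r2: "dual_op \<Delta> ((?p1 ^^ k) a) ((?p2 ^^ k) b) x = dual_op \<Delta> ((?p2 ^^ k) a) b ((d1 ^^ k) x)"
    if "a \<in> dual_space scale" "b \<in> dual_space scale" for k a b x
  proof -
    have "dual_op \<Delta> (?p1 a) (?p2 b) = ?d1 (dual_op \<Delta> (?p2 a) b)"
      if "a \<in> dual_space scale" "b \<in> dual_space scale" for a b
      using arg_cong[OF assms(10), of "dual_tens a b"]
      by (auto simp: dual_tens_tensor_map[OF that] dual_op_def transpose_map_def)
    then have "dual_op \<Delta> ((?p1 ^^ k) a) ((?p2 ^^ k) b) = (?d1 ^^ k) (dual_op \<Delta> ((?p2 ^^ k) a) b)"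
      by (intro intertwine_funpow[of "dual_space scale" "dual_space scale" "\<lambda>b a. dual_op \<Delta> a b"])
        (auto simp: commp that intro: transpose_map_dual plin)
    then show ?thesis by (simp add: transpose_map_funpow) (simp add: transpose_map_def)
  qed

  \<comment> \<open>In the proofs of \<open>l1\<close> and \<open>r1\<close>, the left side lists the indices of \<open>x\<close>, \<open>u\<close> and \<open>y\<close>, the right
    side that of \<open>u\<close> first and then those of the two factors in the order of the product.\<close>
  have l1: "dual_h_elem scale (\<lambda>y. pair_h u (deform scale d1 d2 m y x)) =
      deform fun_scale d1 ?p2 (\<lambda>x. transpose_map (\<lambda>y. m y x)) x u" if u: "u \<in> dual_h scale" for x u
  proof (rule dual_h_elem_eqI)
    show "deform fun_scale d1 ?p2 (\<lambda>x. transpose_map (\<lambda>y. m y x)) x u \<in> dual_h scale"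
      by (intro deform_in_dual_h vs transpose_map_dual[OF mlin(2)] pk coeff u)
    show "pair_h (deform fun_scale d1 ?p2 (\<lambda>x. transpose_map (\<lambda>y. m y x)) x u) y =
        pair_h u (deform scale d1 d2 m y x)" for y
      unfolding fps_eq_iff pair_h_deform_left pair_h_deform_right[OF u] it_l1
      by (intro allI sum.reindex_bij_witness[where j = "\<lambda>(i,j,l,k). (j,l,i,k)" and i = "\<lambda>(j,l,i,k). (i,j,l,k)"])
        (auto simp: quads_def transpose_map_funpow transpose_map_def)
  qed
  have r1: "dual_h_elem scale (\<lambda>y. pair_h u (deform scale d1 d2 m x y)) =
      deform fun_scale d2 ?p1 (\<lambda>x. transpose_map (m x)) x u" if u: "u \<in> dual_h scale" for x u
  proof (rule dual_h_elem_eqI)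
    show "deform fun_scale d2 ?p1 (\<lambda>x. transpose_map (m x)) x u \<in> dual_h scale"
      by (intro deform_in_dual_h vs transpose_map_dual[OF mlin(1)] pk coeff u)
    show "pair_h (deform fun_scale d2 ?p1 (\<lambda>x. transpose_map (m x)) x u) y =
        pair_h u (deform scale d1 d2 m x y)" for y
      unfolding fps_eq_iff pair_h_deform_left pair_h_deform_right[OF u] it_r1
      by (intro allI sum.reindex_bij_witness[where j = "\<lambda>(i,j,l,k). (j,i,l,k)" and i = "\<lambda>(j,i,l,k). (i,j,l,k)"])
        (auto simp: quads_def transpose_map_funpow transpose_map_def)
  qed

  let ?op = "dual_op_h scale (deform_comult scale p1 p2 \<Delta>)"
  let ?l2 = "\<lambda>a x. bidual_elem scale (\<lambda>b. dual_op \<Delta> b a x)"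
  let ?r2 = "\<lambda>a x. bidual_elem scale (\<lambda>b. dual_op \<Delta> a b x)"
  note op2 = dual_op_h_deform_comult[OF vs lin\<Delta>]
  have base: "b (?l2 a x) = dual_op \<Delta> b a x" "b (?r2 a x) = dual_op \<Delta> a b x"
    if "a \<in> dual_space scale" "b \<in> dual_space scale" for a b x
    using that
    by (auto intro: bidual_elem_pair[OF assms(1), where \<phi> = "\<lambda>b. dual_op \<Delta> b a x"]
        bidual_elem_pair[OF assms(1), where \<phi> = "\<lambda>b. dual_op \<Delta> a b x"]
        dual_op_add[OF vs ran\<Delta>] dual_op_scale[OF vs ran\<Delta>])
  have l2: "bidual_h_elem scale (\<lambda>b. pair_h (?op b a) x) = deform scale ?p1 d2 ?l2 a x"
    if a: "a \<in> dual_h scale" for a x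
  proof (rule bidual_h_elem_eqI[OF vs])
    fix b assume b: "b \<in> dual_h scale"
    show "pair_h b (deform scale ?p1 d2 ?l2 a x) = pair_h (?op b a) x"
      unfolding op2[OF b a] fps_eq_iff pair_h_deform_left pair_h_deform_right[OF b]
      by (simp add: base it_l2 pk coeff a b)
  qed
  have r2: "bidual_h_elem scale (\<lambda>b. pair_h (?op a b) x) = deform scale ?p2 d1 ?r2 a x"
    if a: "a \<in> dual_h scale" for a x
  proof (rule bidual_h_elem_eqI[OF vs])
    fix b assume b: "b \<in> dual_h scale"
    show "pair_h b (deform scale ?p2 d1 ?r2 a x) = pair_h (?op a b) x"
      unfolding op2[OF a b] fps_eq_iff pair_h_deform_left pair_h_deform_right[OF b]
      by (intro allI sum.reindex_bij_witness[where j = "\<lambda>(j,i,l,k). (i,j,l,k)" and i = "\<lambda>(i,j,l,k). (j,i,l,k)"])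
        (auto simp: quads_def base it_r2 pk coeff a b)
  qed

  have restr: "restrict1 (map_prod f (transpose_map g)) = f"
    "restrict2 (map_prod f (transpose_map g)) = transpose_map g" for f g :: "'a \<Rightarrow> 'a"
    by (auto simp: restrict1_def restrict2_def fun_eq_iff)
  show ?thesis
    by (simp add: matched_pairs_coincide_def asi_matched_pair_h_def matched_pair_deformation_def
        asi_matched_pair_def Let_def restr l1 r1 l2 r2 op2)
qed

end
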